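(* Let $\mathcal C$ be an additive monoidal category and let $(L,\lambda_L,\Lambda_L)$ be a YB-Lie algebra in $\mathcal C$. Let $\mathsf{Mnd}(L)=(-\otimes L,\boldsymbol\lambda,\boldsymbol\Lambda)$ be the associated Lie monad on $\mathcal C$, where $\boldsymbol\lambda_M=M\otimes\lambda_L$ and $\boldsymbol\Lambda_M=M\otimes\Lambda_L$ for every object $M$. Then there is an equivalence of categories $\mathsf{LieMod}(L)\to\mathsf{EML}(\mathsf{Mnd}(L))$ between the category of right Lie modules over $L$ and the category of Eilenberg-Moore-Lie objects of $\mathsf{Mnd}(L)$.
   Context: Conventions: the tensor product is additive in each variable; associativity and unit constraints are suppressed; an object also denotes its identity morphism. For $c:L\otimes L\to L\otimes L$ put $t_c=(c\otimes L)\circ(L\otimes c)$ and $w_c=(L\otimes c)\circ(c\otimes L)$. A symmetric Yang-Baxter operator on $L$ is a morphism $c:L\otimes L\to L\otimes L$ with $c\circ c=1$ and $(c\otimes L)(L\otimes c)(c\otimes L)=(L\otimes c)(c\otimes L)(L\otimes c)$. A YB-Lie algebra in $\mathcal C$ is a triple $(L,\lambda,\Lambda)$ with $\lambda$ a symmetric Yang-Baxter operator on $L$ and $\Lambda:L\otimes L\to L$ such that $\Lambda\circ(1+\lambda)=0$, $\Lambda\circ(L\otimes\Lambda)\circ(1+t_\lambda+w_\lambda)=0$, and $\lambda\circ(\Lambda\otimes L)=(L\otimes\Lambda)\circ t_\lambda$. A right Lie module over $(L,\lambda,\Lambda)$ is a pair $(X,\varrho)$ with $\varrho:X\otimes L\to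 X$ satisfying $\varrho\circ\big((\varrho\otimes L)-(\varrho\otimes L)\circ(X\otimes\lambda)-X\otimes\Lambda\big)=0$; a morphism $f:(X,\varrho_X)\to(Y,\varrho_Y)$ is a morphism of $\mathcal C$ with $f\circ\varrho_X=\varrho_Y\circ(f\otimes L)$. For an additive endofunctor $\mathbf L$ with natural transformations $\boldsymbol\lambda:\mathbf L\mathbf L\to\mathbf L\mathbf L$ and $\boldsymbol\Lambda:\mathbf L\mathbf L\to\mathbf L$ forming a Lie monad (a YB-Lie algebra in the monoidal category of additive endofunctors), $\mathsf{EML}(\mathbf L)$ has as objects pairs $(X,\varrho_X)$ with $\varrho_X:\mathbf LX\to X$ satisfying $\varrho_X\circ\mathbf L\varrho_X\circ(1_{\mathbf L\mathbf LX}-\boldsymbol\lambda_X)-\varrho_X\circ\boldsymbol\Lambda_X=0$, and as morphisms the $f:X\to Y$ in $\mathcal C$ with $f\circ\varrho_X=\varrho_Y\circ\mathbf Lf$. *)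

theory Defs
  imports "HOL-Algebra.Group"
begin

section \<open>Categories\<close>

record ('o, 'm) cat =
  Obj :: "'o set"
  Arr :: "'m set"
  Src :: "'m \<Rightarrow> 'o"
  Tgt :: "'m \<Rightarrow> 'o"
  Idt :: "'o \<Rightarrow> 'm"
  Cmp :: "'m \<Rightarrow> 'm \<Rightarrow> 'm"  (infixl "\<cdot>\<index>" 70)

definition Hom :: "('o, 'm, 'z) cat_scheme \<Rightarrow> 'o \<Rightarrow> 'o \<Rightarrow> 'm set" where
  "Hom C a b = {f \<in> Arr C. Src C f = a \<and> Tgt C f = b}"

locale category =
  fixes C :: "('o, 'm, 'z) cat_scheme" (structure)
  assumes src_obj: "f \<in> Arr C \<Longrightarrow> Src C f \<in> Obj C"
    and tgt_obj: "f \<in> Arr C \<Longrightarrow> Tgt C f \<in> Obj C"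
    and id_hom: "a \<in> Obj C \<Longrightarrow> Idt C a \<in> Hom C a a"
    and cmp_hom: "\<lbrakk>f \<in> Hom C a b; g \<in> Hom C b c\<rbrakk> \<Longrightarrow> g \<cdot> f \<in> Hom C a c"
    and id_left: "f \<in> Hom C a b \<Longrightarrow> Idt C b \<cdot> f = f"
    and id_right: "f \<in> Hom C a b \<Longrightarrow> f \<cdot> Idt C a = f"
    and cmp_assoc: "\<lbrakk>f \<in> Hom C a b; g \<in> Hom C b c; h \<in> Hom C c d\<rbrakk>
                     \<Longrightarrow> (h \<cdot> g) \<cdot> f = h \<cdot> (g \<cdot> f)"

definition inverse_arrows :: "('o, 'm, 'z) cat_scheme \<Rightarrow> 'm \<Rightarrow> 'm \<Rightarrow> bool" where
  "inverse_arrows C f g \<longleftrightarrow> f \<in> Arr C \<and> g \<in> Hom C (Tgt C f) (Src C f)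
     \<and> g \<cdot>\<^bsub>C\<^esub> f = Idt C (Src C f) \<and> f \<cdot>\<^bsub>C\<^esub> g = Idt C (Tgt C f)"

definition is_iso :: "('o, 'm, 'z) cat_scheme \<Rightarrow> 'm \<Rightarrow> bool" where
  "is_iso C f \<longleftrightarrow> (\<exists>g. inverse_arrows C f g)"

definition Inv :: "('o, 'm, 'z) cat_scheme \<Rightarrow> 'm \<Rightarrow> 'm" where
  "Inv C f = (THE g. inverse_arrows C f g)"


section \<open>Functors, natural transformations, equivalences\<close>

record ('o, 'm, 'p, 'n) fctr =
  OMap :: "'o \<Rightarrow> 'p"
  AMap :: "'m \<Rightarrow> 'n"

text \<open>Functors and natural transformations are extensional, so that equality in HOL is
  equality of functors and of natural transformations.\<close>

definition is_functor ::
  "('o, 'm, 'y) cat_scheme \<Rightarrow> ('p, 'n, 'z) cat_scheme \<Rightarrow> ('o, 'm, 'p, 'n) fctr \<Rightarrow> bool" where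
  "is_functor A B F \<longleftrightarrow> category A \<and> category B
     \<and> OMap F \<in> Obj A \<rightarrow>\<^sub>E Obj B
     \<and> AMap F \<in> extensional (Arr A)
     \<and> (\<forall>a b. \<forall>f\<in>Hom A a b. AMap F f \<in> Hom B (OMap F a) (OMap F b))
     \<and> (\<forall>a\<in>Obj A. AMap F (Idt A a) = Idt B (OMap F a))
     \<and> (\<forall>a b c. \<forall>f\<in>Hom A a b. \<forall>g\<in>Hom A b c. AMap F (g \<cdot>\<^bsub>A\<^esub> f) = AMap F g \<cdot>\<^bsub>B\<^esub> AMap F f)"

definition id_functor :: "('o, 'm, 'z) cat_scheme \<Rightarrow> ('o, 'm, 'o, 'm) fctr" where
  "id_functor A = \<lparr>OMap = (\<lambda>a\<in>Obj A. a), AMap = (\<lambda>f\<in>Arr A. f)\<rparr>"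

definition comp_functor ::
  "('o, 'm, 'z) cat_scheme \<Rightarrow> ('p, 'n, 'q, 'l) fctr \<Rightarrow> ('o, 'm, 'p, 'n) fctr
     \<Rightarrow> ('o, 'm, 'q, 'l) fctr" where
  "comp_functor A G F = \<lparr>OMap = compose (Obj A) (OMap G) (OMap F),
                         AMap = compose (Arr A) (AMap G) (AMap F)\<rparr>"

record ('o, 'm, 'p, 'n) ntrans =
  NSrc :: "('o, 'm, 'p, 'n) fctr"
  NTgt :: "('o, 'm, 'p, 'n) fctr"
  At :: "'o \<Rightarrow> 'n"

definition is_ntrans ::
  "('o, 'm, 'y) cat_scheme \<Rightarrow> ('p, 'n, 'z) cat_scheme \<Rightarrow> ('o, 'm, 'p, 'n) ntrans \<Rightarrow> bool" where
  "is_ntrans A B \<eta> \<longleftrightarrow> is_functor A B (NSrc \<eta>) \<and> is_functor A B (NTgt \<eta>)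
     \<and> At \<eta> \<in> extensional (Obj A)
     \<and> (\<forall>a\<in>Obj A. At \<eta> a \<in> Hom B (OMap (NSrc \<eta>) a) (OMap (NTgt \<eta>) a))
     \<and> (\<forall>a b. \<forall>f\<in>Hom A a b.
          At \<eta> b \<cdot>\<^bsub>B\<^esub> AMap (NSrc \<eta>) f = AMap (NTgt \<eta>) f \<cdot>\<^bsub>B\<^esub> At \<eta> a)"

definition naturally_isomorphic ::
  "('o, 'm, 'y) cat_scheme \<Rightarrow> ('p, 'n, 'z) cat_scheme
     \<Rightarrow> ('o, 'm, 'p, 'n) fctr \<Rightarrow> ('o, 'm, 'p, 'n) fctr \<Rightarrow> bool" where
  "naturally_isomorphic A B F G \<longleftrightarrow>
     (\<exists>\<eta>. is_ntrans A B \<eta> \<and> NSrc \<eta> = F \<and> NTgt \<eta> = G \<and> (\<forall>a\<in>Obj A. is_iso B (At \<eta> a)))"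

definition is_equivalence ::
  "('o, 'm, 'y) cat_scheme \<Rightarrow> ('p, 'n, 'z) cat_scheme \<Rightarrow> ('o, 'm, 'p, 'n) fctr \<Rightarrow> bool" where
  "is_equivalence A B F \<longleftrightarrow> is_functor A B F \<and>
     (\<exists>G. is_functor B A G
        \<and> naturally_isomorphic A A (comp_functor A G F) (id_functor A)
        \<and> naturally_isomorphic B B (comp_functor B F G) (id_functor B))"


section \<open>Additive categories\<close>

record ('o, 'm) add_cat = "('o, 'm) cat" +
  Add :: "'m \<Rightarrow> 'm \<Rightarrow> 'm"  (infixl "\<oplus>\<index>" 65)
  Zero :: "'o \<Rightarrow> 'o \<Rightarrow> 'm"

definition hom_group :: "('o, 'm, 'z) add_cat_scheme \<Rightarrow> 'o \<Rightarrow> 'o \<Rightarrow> 'm monoid" where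
  "hom_group C a b = \<lparr>carrier = Hom C a b, monoid.mult = Add C, one = Zero C a b\<rparr>"

definition Sub :: "('o, 'm, 'z) add_cat_scheme \<Rightarrow> 'm \<Rightarrow> 'm \<Rightarrow> 'm"
    (infixl "\<ominus>\<index>" 65) where
  "f \<ominus>\<^bsub>C\<^esub> g = f \<oplus>\<^bsub>C\<^esub> inv\<^bsub>hom_group C (Src C g) (Tgt C g)\<^esub> g"

locale preadditive_category = category C
  for C :: "('o, 'm, 'z) add_cat_scheme" (structure) +
  assumes hom_comm_group: "\<lbrakk>a \<in> Obj C; b \<in> Obj C\<rbrakk> \<Longrightarrow> comm_group (hom_group C a b)"
    and cmp_add_left: "\<lbrakk>f \<in> Hom C a b; g \<in> Hom C b c; h \<in> Hom C b c\<rbrakk>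
                        \<Longrightarrow> (g \<oplus> h) \<cdot> f = g \<cdot> f \<oplus> h \<cdot> f"
    and cmp_add_right: "\<lbrakk>f \<in> Hom C a b; g \<in> Hom C a b; h \<in> Hom C b c\<rbrakk>
                        \<Longrightarrow> h \<cdot> (f \<oplus> g) = h \<cdot> f \<oplus> h \<cdot> g"

locale additive_category = preadditive_category C
  for C :: "('o, 'm, 'z) add_cat_scheme" (structure) +
  assumes zero_object: "\<exists>z\<in>Obj C. \<forall>a\<in>Obj C. (\<exists>!f. f \<in> Hom C a z) \<and> (\<exists>!f. f \<in> Hom C z a)"
    and biproduct: "\<lbrakk>a \<in> Obj C; b \<in> Obj C\<rbrakk> \<Longrightarrow>
      \<exists>s\<in>Obj C. \<exists>i\<in>Hom C a s. \<exists>j\<in>Hom C b s. \<exists>p\<in>Hom C s a. \<exists>q\<in>Hom C s b.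
        p \<cdot> i = Idt C a \<and> q \<cdot> j = Idt C b \<and> p \<cdot> j = Zero C b a \<and> q \<cdot> i = Zero C a b
        \<and> i \<cdot> p \<oplus> j \<cdot> q = Idt C s"

definition is_additive_functor ::
  "('o, 'm, 'y) add_cat_scheme \<Rightarrow> ('p, 'n, 'z) add_cat_scheme
     \<Rightarrow> ('o, 'm, 'p, 'n) fctr \<Rightarrow> bool" where
  "is_additive_functor A B F \<longleftrightarrow> is_functor A B F
     \<and> (\<forall>a b. \<forall>f\<in>Hom A a b. \<forall>g\<in>Hom A a b. AMap F (f \<oplus>\<^bsub>A\<^esub> g) = AMap F f \<oplus>\<^bsub>B\<^esub> AMap F g)"


section \<open>Additive monoidal categories\<close>

text \<open>The monoidal structure is not assumed to be strict: the associativity constraint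
  \<open>Asc C a b c : (a \<odot> b) \<odot> c \<rightarrow> a \<odot> (b \<odot> c)\<close> and the unit constraints are part of the data.
  The tensor product is written \<open>\<odot>\<close> on objects and \<open>\<boxtimes>\<close> on arrows.\<close>

record ('o, 'm) mon_cat = "('o, 'm) add_cat" +
  TObj :: "'o \<Rightarrow> 'o \<Rightarrow> 'o"  (infixl "\<odot>\<index>" 75)
  TArr :: "'m \<Rightarrow> 'm \<Rightarrow> 'm"  (infixl "\<boxtimes>\<index>" 75)
  Unt :: "'o"
  Asc :: "'o \<Rightarrow> 'o \<Rightarrow> 'o \<Rightarrow> 'm"
  LUn :: "'o \<Rightarrow> 'm"
  RUn :: "'o \<Rightarrow> 'm"

locale additive_monoidal_category = additive_category C
  for C :: "('o, 'm, 'z) mon_cat_scheme" (structure) +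
  assumes tensor_obj: "\<lbrakk>a \<in> Obj C; b \<in> Obj C\<rbrakk> \<Longrightarrow> a \<odot> b \<in> Obj C"
    and tensor_hom: "\<lbrakk>f \<in> Hom C a a'; g \<in> Hom C b b'\<rbrakk> \<Longrightarrow> f \<boxtimes> g \<in> Hom C (a \<odot> b) (a' \<odot> b')"
    and tensor_id: "\<lbrakk>a \<in> Obj C; b \<in> Obj C\<rbrakk> \<Longrightarrow> Idt C a \<boxtimes> Idt C b = Idt C (a \<odot> b)"
    and tensor_cmp: "\<lbrakk>f \<in> Hom C a b; g \<in> Hom C b c; f' \<in> Hom C a' b'; g' \<in> Hom C b' c'\<rbrakk>
                      \<Longrightarrow> (g \<cdot> f) \<boxtimes> (g' \<cdot> f') = (g \<boxtimes> g') \<cdot> (f \<boxtimes> f')"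
    and tensor_add_left: "\<lbrakk>f \<in> Hom C a b; g \<in> Hom C a b; h \<in> Hom C c d\<rbrakk>
                      \<Longrightarrow> (f \<oplus> g) \<boxtimes> h = f \<boxtimes> h \<oplus> g \<boxtimes> h"
    and tensor_add_right: "\<lbrakk>f \<in> Hom C a b; g \<in> Hom C a b; h \<in> Hom C c d\<rbrakk>
                      \<Longrightarrow> h \<boxtimes> (f \<oplus> g) = h \<boxtimes> f \<oplus> h \<boxtimes> g"
    and unit_obj: "Unt C \<in> Obj C"
    and asc_hom: "\<lbrakk>a \<in> Obj C; b \<in> Obj C; c \<in> Obj C\<rbrakk>
                      \<Longrightarrow> Asc C a b c \<in> Hom C ((a \<odot> b) \<odot> c) (a \<odot> (b \<odot> c))"
    and asc_iso: "\<lbrakk>a \<in> Obj C; b \<in> Obj C; c \<in> Obj C\<rbrakk> \<Longrightarrow> is_iso C (Asc C a b c)"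
    and asc_natural: "\<lbrakk>f \<in> Hom C a a'; g \<in> Hom C b b'; h \<in> Hom C c c'\<rbrakk>
                      \<Longrightarrow> Asc C a' b' c' \<cdot> ((f \<boxtimes> g) \<boxtimes> h) = (f \<boxtimes> (g \<boxtimes> h)) \<cdot> Asc C a b c"
    and lun_hom: "a \<in> Obj C \<Longrightarrow> LUn C a \<in> Hom C (Unt C \<odot> a) a"
    and lun_iso: "a \<in> Obj C \<Longrightarrow> is_iso C (LUn C a)"
    and lun_natural: "f \<in> Hom C a b \<Longrightarrow> LUn C b \<cdot> (Idt C (Unt C) \<boxtimes> f) = f \<cdot> LUn C a"
    and run_hom: "a \<in> Obj C \<Longrightarrow> RUn C a \<in> Hom C (a \<odot> Unt C) a"
    and run_iso: "a \<in> Obj C \<Longrightarrow> is_iso C (RUn C a)"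
    and run_natural: "f \<in> Hom C a b \<Longrightarrow> RUn C b \<cdot> (f \<boxtimes> Idt C (Unt C)) = f \<cdot> RUn C a"
    and pentagon: "\<lbrakk>a \<in> Obj C; b \<in> Obj C; c \<in> Obj C; d \<in> Obj C\<rbrakk> \<Longrightarrow>
      Asc C a b (c \<odot> d) \<cdot> Asc C (a \<odot> b) c d
        = (Idt C a \<boxtimes> Asc C b c d) \<cdot> Asc C a (b \<odot> c) d \<cdot> (Asc C a b c \<boxtimes> Idt C d)"
    and triangle: "\<lbrakk>a \<in> Obj C; b \<in> Obj C\<rbrakk> \<Longrightarrow>
      (Idt C a \<boxtimes> LUn C b) \<cdot> Asc C a (Unt C) b = RUn C a \<boxtimes> Idt C b"


section \<open>YB-Lie algebras and their modules\<close>

text \<open>The suppressed associativity constraints are made explicit by bracketing threefold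
  tensor products to the left.  Thus for \<open>c : L \<odot> L \<rightarrow> L \<odot> L\<close> and \<open>m : L \<odot> L \<rightarrow> L\<close> the
  morphisms ``\<open>X \<otimes> c\<close>'' and ``\<open>X \<otimes> m\<close>'' are read as
  \<open>tens2 C X L c : (X \<odot> L) \<odot> L \<rightarrow> (X \<odot> L) \<odot> L\<close> and \<open>tens1 C X L m : (X \<odot> L) \<odot> L \<rightarrow> X \<odot> L\<close>.\<close>

definition tens2 :: "('o, 'm, 'z) mon_cat_scheme \<Rightarrow> 'o \<Rightarrow> 'o \<Rightarrow> 'm \<Rightarrow> 'm" where
  "tens2 C X L c = Inv C (Asc C X L L) \<cdot>\<^bsub>C\<^esub> (Idt C X \<boxtimes>\<^bsub>C\<^esub> c) \<cdot>\<^bsub>C\<^esub> Asc C X L L"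

definition tens1 :: "('o, 'm, 'z) mon_cat_scheme \<Rightarrow> 'o \<Rightarrow> 'o \<Rightarrow> 'm \<Rightarrow> 'm" where
  "tens1 C X L m = (Idt C X \<boxtimes>\<^bsub>C\<^esub> m) \<cdot>\<^bsub>C\<^esub> Asc C X L L"

definition tperm :: "('o, 'm, 'z) mon_cat_scheme \<Rightarrow> 'o \<Rightarrow> 'm \<Rightarrow> 'm" where
  "tperm C L c = (c \<boxtimes>\<^bsub>C\<^esub> Idt C L) \<cdot>\<^bsub>C\<^esub> tens2 C L L c"

definition wperm :: "('o, 'm, 'z) mon_cat_scheme \<Rightarrow> 'o \<Rightarrow> 'm \<Rightarrow> 'm" where
  "wperm C L c = tens2 C L L c \<cdot>\<^bsub>C\<^esub> (c \<boxtimes>\<^bsub>C\<^esub> Idt C L)"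

definition symmetric_yang_baxter :: "('o, 'm, 'z) mon_cat_scheme \<Rightarrow> 'o \<Rightarrow> 'm \<Rightarrow> bool" where
  "symmetric_yang_baxter C L c \<longleftrightarrow>
     c \<in> Hom C (L \<odot>\<^bsub>C\<^esub> L) (L \<odot>\<^bsub>C\<^esub> L)
     \<and> c \<cdot>\<^bsub>C\<^esub> c = Idt C (L \<odot>\<^bsub>C\<^esub> L)
     \<and> (c \<boxtimes>\<^bsub>C\<^esub> Idt C L) \<cdot>\<^bsub>C\<^esub> tens2 C L L c \<cdot>\<^bsub>C\<^esub> (c \<boxtimes>\<^bsub>C\<^esub> Idt C L)
         = tens2 C L L c \<cdot>\<^bsub>C\<^esub> (c \<boxtimes>\<^bsub>C\<^esub> Idt C L) \<cdot>\<^bsub>C\<^esub> tens2 C L L c"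

fun yb_lie_algebra :: "('o, 'm, 'z) mon_cat_scheme \<Rightarrow> 'o \<times> 'm \<times> 'm \<Rightarrow> bool" where
  "yb_lie_algebra C (L, lam, Lam) \<longleftrightarrow>
     L \<in> Obj C
     \<and> symmetric_yang_baxter C L lam
     \<and> Lam \<in> Hom C (L \<odot>\<^bsub>C\<^esub> L) L
     \<and> Lam \<cdot>\<^bsub>C\<^esub> (Idt C (L \<odot>\<^bsub>C\<^esub> L) \<oplus>\<^bsub>C\<^esub> lam) = Zero C (L \<odot>\<^bsub>C\<^esub> L) L
     \<and> Lam \<cdot>\<^bsub>C\<^esub> tens1 C L L Lam
         \<cdot>\<^bsub>C\<^esub> (Idt C ((L \<odot>\<^bsub>C\<^esub> L) \<odot>\<^bsub>C\<^esub> L) \<oplus>\<^bsub>C\<^esub> tperm C L lam \<oplus>\<^bsub>C\<^esub> wperm C L lam)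
         = Zero C ((L \<odot>\<^bsub>C\<^esub> L) \<odot>\<^bsub>C\<^esub> L) L
     \<and> lam \<cdot>\<^bsub>C\<^esub> (Lam \<boxtimes>\<^bsub>C\<^esub> Idt C L) = tens1 C L L Lam \<cdot>\<^bsub>C\<^esub> tperm C L lam"

text \<open>The category of pairs \<open>(X, \<rho>)\<close> in \<open>S\<close> whose morphisms are the \<open>f : X \<rightarrow> Y\<close> in \<open>C\<close>
  satisfying the compatibility \<open>R\<close>; an arrow carries its source and target.\<close>

definition structured_cat ::
  "('o, 'm, 'z) cat_scheme \<Rightarrow> ('o \<times> 'm) set \<Rightarrow> ('o \<times> 'm \<Rightarrow> 'o \<times> 'm \<Rightarrow> 'm \<Rightarrow> bool)
     \<Rightarrow> ('o \<times> 'm, ('o \<times> 'm) \<times> ('o \<times> 'm) \<times> 'm) cat" where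
  "structured_cat C S R =
     \<lparr>Obj = S,
      Arr = {(M, N, f). M \<in> S \<and> N \<in> S \<and> f \<in> Hom C (fst M) (fst N) \<and> R M N f},
      Src = (\<lambda>(M, N, f). M),
      Tgt = (\<lambda>(M, N, f). N),
      Idt = (\<lambda>M. (M, M, Idt C (fst M))),
      Cmp = (\<lambda>(M', N', g) (M, N, f). (M, N', g \<cdot>\<^bsub>C\<^esub> f))\<rparr>"

fun is_lie_module ::
  "('o, 'm, 'z) mon_cat_scheme \<Rightarrow> 'o \<times> 'm \<times> 'm \<Rightarrow> 'o \<times> 'm \<Rightarrow> bool" where
  "is_lie_module C (L, lam, Lam) (X, \<rho>) \<longleftrightarrow>
     X \<in> Obj C
     \<and> \<rho> \<in> Hom C (X \<odot>\<^bsub>C\<^esub> L) X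
     \<and> \<rho> \<cdot>\<^bsub>C\<^esub> ((\<rho> \<boxtimes>\<^bsub>C\<^esub> Idt C L)
             \<ominus>\<^bsub>C\<^esub> (\<rho> \<boxtimes>\<^bsub>C\<^esub> Idt C L) \<cdot>\<^bsub>C\<^esub> tens2 C X L lam
             \<ominus>\<^bsub>C\<^esub> tens1 C X L Lam)
         = Zero C ((X \<odot>\<^bsub>C\<^esub> L) \<odot>\<^bsub>C\<^esub> L) X"

fun lie_module_morphism ::
  "('o, 'm, 'z) mon_cat_scheme \<Rightarrow> 'o \<times> 'm \<times> 'm \<Rightarrow> 'o \<times> 'm \<Rightarrow> 'o \<times> 'm \<Rightarrow> 'm \<Rightarrow> bool" where
  "lie_module_morphism C (L, lam, Lam) (X, \<rho>) (Y, \<sigma>) f \<longleftrightarrow>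
     f \<cdot>\<^bsub>C\<^esub> \<rho> = \<sigma> \<cdot>\<^bsub>C\<^esub> (f \<boxtimes>\<^bsub>C\<^esub> Idt C L)"

definition LieMod ::
  "('o, 'm, 'z) mon_cat_scheme \<Rightarrow> 'o \<times> 'm \<times> 'm
     \<Rightarrow> ('o \<times> 'm, ('o \<times> 'm) \<times> ('o \<times> 'm) \<times> 'm) cat" where
  "LieMod C A = structured_cat C {M. is_lie_module C A M} (lie_module_morphism C A)"


section \<open>Lie monads\<close>

text \<open>The additive monoidal category of additive endofunctors and natural transformations,
  with \<open>F \<odot> G = F \<circ> G\<close>; on natural transformations, \<open>\<boxtimes>\<close> is horizontal composition.
  It is strict, so its constraints are identities.\<close>

definition id_ntrans ::
  "('o, 'm, 'z) cat_scheme \<Rightarrow> ('o, 'm, 'o, 'm) fctr \<Rightarrow> ('o, 'm, 'o, 'm) ntrans" where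
  "id_ntrans C F = \<lparr>NSrc = F, NTgt = F, At = (\<lambda>a\<in>Obj C. Idt C (OMap F a))\<rparr>"

definition AddEnd ::
  "('o, 'm, 'z) add_cat_scheme \<Rightarrow> (('o, 'm, 'o, 'm) fctr, ('o, 'm, 'o, 'm) ntrans) mon_cat" where
  "AddEnd C =
     \<lparr>Obj = {F. is_additive_functor C C F},
      Arr = {\<eta>. is_ntrans C C \<eta> \<and> is_additive_functor C C (NSrc \<eta>)
                  \<and> is_additive_functor C C (NTgt \<eta>)},
      Src = NSrc,
      Tgt = NTgt,
      Idt = id_ntrans C,
      Cmp = (\<lambda>\<theta> \<eta>. \<lparr>NSrc = NSrc \<eta>, NTgt = NTgt \<theta>, At = (\<lambda>a\<in>Obj C. At \<theta> a \<cdot>\<^bsub>C\<^esub> At \<eta> a)\<rparr>),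
      Add = (\<lambda>\<eta> \<theta>. \<lparr>NSrc = NSrc \<eta>, NTgt = NTgt \<eta>, At = (\<lambda>a\<in>Obj C. At \<eta> a \<oplus>\<^bsub>C\<^esub> At \<theta> a)\<rparr>),
      Zero = (\<lambda>F G. \<lparr>NSrc = F, NTgt = G, At = (\<lambda>a\<in>Obj C. Zero C (OMap F a) (OMap G a))\<rparr>),
      TObj = comp_functor C,
      TArr = (\<lambda>\<eta> \<theta>. \<lparr>NSrc = comp_functor C (NSrc \<eta>) (NSrc \<theta>),
                      NTgt = comp_functor C (NTgt \<eta>) (NTgt \<theta>),
                      At = (\<lambda>a\<in>Obj C. At \<eta> (OMap (NTgt \<theta>) a) \<cdot>\<^bsub>C\<^esub> AMap (NSrc \<eta>) (At \<theta> a))\<rparr>),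
      Unt = id_functor C,
      Asc = (\<lambda>F G H. id_ntrans C (comp_functor C F (comp_functor C G H))),
      LUn = id_ntrans C,
      RUn = id_ntrans C\<rparr>"

definition lie_monad ::
  "('o, 'm, 'z) add_cat_scheme
     \<Rightarrow> ('o, 'm, 'o, 'm) fctr \<times> ('o, 'm, 'o, 'm) ntrans \<times> ('o, 'm, 'o, 'm) ntrans \<Rightarrow> bool" where
  "lie_monad C T \<longleftrightarrow> yb_lie_algebra (AddEnd C) T"

fun is_eml_object ::
  "('o, 'm, 'z) add_cat_scheme
     \<Rightarrow> ('o, 'm, 'o, 'm) fctr \<times> ('o, 'm, 'o, 'm) ntrans \<times> ('o, 'm, 'o, 'm) ntrans
     \<Rightarrow> 'o \<times> 'm \<Rightarrow> bool" where
  "is_eml_object C (T, lam, Lam) (X, \<rho>) \<longleftrightarrow>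
     X \<in> Obj C
     \<and> \<rho> \<in> Hom C (OMap T X) X
     \<and> \<rho> \<cdot>\<^bsub>C\<^esub> AMap T \<rho> \<cdot>\<^bsub>C\<^esub> (Idt C (OMap T (OMap T X)) \<ominus>\<^bsub>C\<^esub> At lam X) \<ominus>\<^bsub>C\<^esub> \<rho> \<cdot>\<^bsub>C\<^esub> At Lam X
         = Zero C (OMap T (OMap T X)) X"

fun eml_morphism ::
  "('o, 'm, 'z) add_cat_scheme
     \<Rightarrow> ('o, 'm, 'o, 'm) fctr \<times> ('o, 'm, 'o, 'm) ntrans \<times> ('o, 'm, 'o, 'm) ntrans
     \<Rightarrow> 'o \<times> 'm \<Rightarrow> 'o \<times> 'm \<Rightarrow> 'm \<Rightarrow> bool" where
  "eml_morphism C (T, lam, Lam) (X, \<rho>) (Y, \<sigma>) f \<longleftrightarrow> f \<cdot>\<^bsub>C\<^esub> \<rho> = \<sigma> \<cdot>\<^bsub>C\<^esub> AMap T f"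

definition EML ::
  "('o, 'm, 'z) add_cat_scheme
     \<Rightarrow> ('o, 'm, 'o, 'm) fctr \<times> ('o, 'm, 'o, 'm) ntrans \<times> ('o, 'm, 'o, 'm) ntrans
     \<Rightarrow> ('o \<times> 'm, ('o \<times> 'm) \<times> ('o \<times> 'm) \<times> 'm) cat" where
  "EML C T = structured_cat C {M. is_eml_object C T M} (eml_morphism C T)"

definition tensor_functor :: "('o, 'm, 'z) mon_cat_scheme \<Rightarrow> 'o \<Rightarrow> ('o, 'm, 'o, 'm) fctr" where
  "tensor_functor C L = \<lparr>OMap = (\<lambda>a\<in>Obj C. a \<odot>\<^bsub>C\<^esub> L), AMap = (\<lambda>f\<in>Arr C. f \<boxtimes>\<^bsub>C\<^esub> Idt C L)\<rparr>"

fun Mnd ::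
  "('o, 'm, 'z) mon_cat_scheme \<Rightarrow> 'o \<times> 'm \<times> 'm
     \<Rightarrow> ('o, 'm, 'o, 'm) fctr \<times> ('o, 'm, 'o, 'm) ntrans \<times> ('o, 'm, 'o, 'm) ntrans" where
  "Mnd C (L, lam, Lam) =
     (let T = tensor_functor C L; TT = comp_functor C T T in
       (T,
        \<lparr>NSrc = TT, NTgt = TT, At = (\<lambda>M\<in>Obj C. tens2 C M L lam)\<rparr>,
        \<lparr>NSrc = TT, NTgt = T, At = (\<lambda>M\<in>Obj C. tens1 C M L Lam)\<rparr>))"

end

theory Submission
  imports Defs
begin

text \<open>The two categories are literally equal: by bilinearity of composition, the module identity
  over \<open>L\<close> is the Eilenberg-Moore-Lie identity of \<open>- \<otimes> L\<close>, so the identity functor is an equivalence.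
  That \<open>- \<otimes> L\<close> is a Lie monad is checked at each object \<open>M\<close>.  Up to rebracketing, every composite of
  whiskered components there is \<open>M \<otimes> f\<close> for a composite \<open>f\<close> of the structure maps of \<open>L\<close>, except that
  the order of tensor factors is reversed; the reversed axioms follow from the given ones.\<close>

text \<open>The reversal comes from taking composition as the tensor product of endofunctors. For
  \<open>T\<close> = - \<otimes> L, whiskering a transformation by \<open>T\<close> on the left
  applies \<open>T\<close> to its component at M, so the copies of L next to M are acted on;
  whiskering on the right evaluates it at \<open>M \<odot> L\<close>, so the last copies are. Hence
  the Jacobi identity of the monad unfolds to brackets nested on the left, while the one given for L
  is nested on the right. Since \<open>lam\<close> is an involution, the compatibility of
  \<open>lam\<close> with \<open>Lam\<close> can be solved for either bracket, and antisymmetry then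
  trades one nesting for the other. The other obstacle is bracketing: C has genuine associativity
  constraints, whereas those of \<open>AddEnd C\<close> are identities. A morphism of left-bracketed
  products headed by M is therefore compared with a morphism between powers of L through a square
  with invertible vertical sides. Such squares compose and add, and the lower edge determines the
  upper one, so an identity on L carries over to every M without any chasing of constraints in the
  identity itself.\<close>

context category
begin

section \<open>Typing of arrows and isomorphisms in a category\<close>

lemma homD:
  assumes "f \<in> Hom C a b"
  shows "f \<in> Arr C" "Src C f = a" "Tgt C f = b" "a \<in> Obj C" "b \<in> Obj C"
  using assms src_obj tgt_obj by (auto simp: Hom_def)

lemma homI: "\<lbrakk>f \<in> Arr C; Src C f = a; Tgt C f = b\<rbrakk> \<Longrightarrow> f \<in> Hom C a b"
  by (simp add: Hom_def)

lemma hom_self: "f \<in> Arr C \<Longrightarrow> f \<in> Hom C (Src C f) (Tgt C f)"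
  by (simp add: Hom_def)

text \<open>Here and in the rules that follow, typing is expressed by \<open>Src\<close> and
  \<open>Tgt\<close> instead of \<open>Hom\<close>: the side conditions become equations that the
  simplifier can discharge, whereas the intermediate objects in \<open>cmp_hom\<close> or
  \<open>cmp_assoc\<close> would have to be guessed.\<close>

lemma arr_id [simp]:
  assumes "a \<in> Obj C"
  shows "Idt C a \<in> Arr C" "Src C (Idt C a) = a" "Tgt C (Idt C a) = a"
  using homD[OF id_hom[OF assms]] by auto

lemma arr_cmp [simp]:
  assumes "f \<in> Arr C" "g \<in> Arr C" "Src C g = Tgt C f"
  shows "g \<cdot> f \<in> Arr C" "Src C (g \<cdot> f) = Src C f" "Tgt C (g \<cdot> f) = Tgt C g"
  using homD[OF cmp_hom[OF hom_self[OF assms(1)]], of g "Tgt C g"] hom_self[OF assms(2)] assms(3)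
  by auto

lemma arr_id_left [simp]: "\<lbrakk>f \<in> Arr C; Tgt C f = b\<rbrakk> \<Longrightarrow> Idt C b \<cdot> f = f"
  using id_left hom_self by blast

lemma arr_id_right [simp]: "\<lbrakk>f \<in> Arr C; Src C f = a\<rbrakk> \<Longrightarrow> f \<cdot> Idt C a = f"
  using id_right hom_self by blast

lemma arr_assoc:
  "\<lbrakk>f \<in> Arr C; g \<in> Arr C; h \<in> Arr C; Src C g = Tgt C f; Src C h = Tgt C g\<rbrakk>
    \<Longrightarrow> (h \<cdot> g) \<cdot> f = h \<cdot> (g \<cdot> f)"
  using cmp_assoc[of f "Src C f" "Tgt C f" g "Tgt C g" h "Tgt C h"] by (simp add: Hom_def)

lemma inverse_arrows_unique:
  assumes "inverse_arrows C f g" "inverse_arrows C f h"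
  shows "g = h"
proof -
  have f: "f \<in> Arr C" and g: "g \<in> Hom C (Tgt C f) (Src C f)" and h: "h \<in> Hom C (Tgt C f) (Src C f)"
    using assms by (auto simp: inverse_arrows_def)
  have "g = g \<cdot> (f \<cdot> h)"
    using assms homD[OF g] by (simp add: inverse_arrows_def)
  also have "\<dots> = (g \<cdot> f) \<cdot> h"
    using f homD[OF g] homD[OF h] by (simp add: arr_assoc)
  also have "\<dots> = h"
    using assms homD[OF h] by (simp add: inverse_arrows_def)
  finally show ?thesis .
qed

lemma Inv_eqI: "inverse_arrows C f g \<Longrightarrow> Inv C f = g"
  unfolding Inv_def using inverse_arrows_unique by blast

lemma inverse_arrows_Inv:
  assumes "is_iso C f" shows "inverse_arrows C f (Inv C f)"
  using assms Inv_eqI unfolding is_iso_def by auto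

lemma iso_Inv [simp]:
  assumes "is_iso C f"
  shows "Inv C f \<in> Arr C" "Src C (Inv C f) = Tgt C f" "Tgt C (Inv C f) = Src C f"
    "Inv C f \<cdot> f = Idt C (Src C f)" "f \<cdot> Inv C f = Idt C (Tgt C f)"
  using inverse_arrows_Inv[OF assms] by (auto simp: inverse_arrows_def Hom_def)

lemma iso_arr: "is_iso C f \<Longrightarrow> f \<in> Arr C"
  by (auto simp: is_iso_def inverse_arrows_def)

lemma isoI:
  assumes "f \<in> Hom C a b" "g \<in> Hom C b a" "g \<cdot> f = Idt C a" "f \<cdot> g = Idt C b"
  shows "is_iso C f"
  using assms by (auto simp: is_iso_def inverse_arrows_def Hom_def)

lemma iso_id: "a \<in> Obj C \<Longrightarrow> is_iso C (Idt C a)"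
  by (rule isoI[of _ a a "Idt C a"]) (auto simp: id_hom)

lemma iso_cmp:
  assumes "is_iso C f" "is_iso C g" "Src C g = Tgt C f"
  shows "is_iso C (g \<cdot> f)"
proof (rule isoI)
  note [simp] = iso_arr[OF assms(1)] iso_arr[OF assms(2)] assms src_obj tgt_obj
  show "g \<cdot> f \<in> Hom C (Src C f) (Tgt C g)" "Inv C f \<cdot> Inv C g \<in> Hom C (Tgt C g) (Src C f)"
    by (auto intro!: homI)
  \<comment> \<open>The cancellation rules are switched off so that both sides reach the same
    right-nested form; otherwise the inner pair on the right would collapse before the sides are
    compared.\<close>
  have "(Inv C f \<cdot> Inv C g) \<cdot> (g \<cdot> f) = Inv C f \<cdot> ((Inv C g \<cdot> g) \<cdot> f)"
    by (simp add: arr_assoc del: iso_Inv(4,5))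
  then show "(Inv C f \<cdot> Inv C g) \<cdot> (g \<cdot> f) = Idt C (Src C f)" by simp
  have "(g \<cdot> f) \<cdot> (Inv C f \<cdot> Inv C g) = g \<cdot> ((f \<cdot> Inv C f) \<cdot> Inv C g)"
    by (simp add: arr_assoc del: iso_Inv(4,5))
  then show "(g \<cdot> f) \<cdot> (Inv C f \<cdot> Inv C g) = Idt C (Tgt C g)" by simp
qed

text \<open>Left cancellation. It allows a morphism built with \<open>Inv\<close> to be compared
  after composition with the constraint itself, where the inverse disappears.\<close>

lemma iso_mono:
  assumes "is_iso C f" "g \<in> Arr C" "h \<in> Arr C" "Tgt C g = Src C f" "Tgt C h = Src C f"
    and "f \<cdot> g = f \<cdot> h"
  shows "g = h"
proof -
  have "(Inv C f \<cdot> f) \<cdot> g = (Inv C f \<cdot> f) \<cdot> h"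
    using assms iso_arr[OF assms(1)] by (simp add: arr_assoc del: iso_Inv(4,5))
  with assms show ?thesis by simp
qed

section \<open>Categories of structured objects and the identity equivalence\<close>

lemma category_structured_cat:
  assumes obj: "\<And>M. M \<in> S \<Longrightarrow> fst M \<in> Obj C"
    and idt: "\<And>M. M \<in> S \<Longrightarrow> R M M (Idt C (fst M))"
    and cmp: "\<And>M N P f g. \<lbrakk>M \<in> S; N \<in> S; P \<in> S; f \<in> Hom C (fst M) (fst N);
      g \<in> Hom C (fst N) (fst P); R M N f; R N P g\<rbrakk> \<Longrightarrow> R M P (g \<cdot> f)"
  shows "category (structured_cat C S R)"
proof
  let ?S = "structured_cat C S R"
  have hom: "h \<in> Hom ?S M N \<longleftrightarrow> (\<exists>f. h = (M, N, f) \<and> M \<in> S \<and> N \<in> S \<and> f \<in> Hom C (fst M) (fst N) \<and> R M N f)"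
    for h M N
    by (auto simp: structured_cat_def Hom_def)
  show "Src ?S h \<in> Obj ?S" "Tgt ?S h \<in> Obj ?S" if "h \<in> Arr ?S" for h
    using that by (auto simp: structured_cat_def)
  show "Idt ?S M \<in> Hom ?S M M" if "M \<in> Obj ?S" for M
    unfolding hom using that obj idt id_hom by (auto simp: structured_cat_def)
  show "Cmp ?S g f \<in> Hom ?S M P" if fg: "f \<in> Hom ?S M N" "g \<in> Hom ?S N P" for f g M N P
  proof -
    obtain f' g' where "f = (M, N, f')" "g = (N, P, g')" "M \<in> S" "N \<in> S" "P \<in> S"
      "f' \<in> Hom C (fst M) (fst N)" "g' \<in> Hom C (fst N) (fst P)" "R M N f'" "R N P g'"
      using fg unfolding hom by blast
    moreover from this have "g' \<cdot> f' \<in> Hom C (fst M) (fst P)" "R M P (g' \<cdot> f')"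
      using cmp_hom cmp by blast+
    ultimately show ?thesis unfolding hom by (simp add: structured_cat_def)
  qed
  show "Cmp ?S (Idt ?S N) f = f" "Cmp ?S f (Idt ?S M) = f" if "f \<in> Hom ?S M N" for f M N
    using that unfolding hom by (auto simp: structured_cat_def homD)
  show "Cmp ?S (Cmp ?S h g) f = Cmp ?S h (Cmp ?S g f)"
    if "f \<in> Hom ?S M N" "g \<in> Hom ?S N P" "h \<in> Hom ?S P Q" for f g h M N P Q
    using that unfolding hom by (auto simp: structured_cat_def intro: cmp_assoc)
qed

lemma is_functor_id: "is_functor C C (id_functor C)"
  unfolding is_functor_def id_functor_def
  using category_axioms by (auto simp: Hom_def src_obj tgt_obj)

lemma naturally_isomorphic_refl:
  assumes "is_functor B C F"
  shows "naturally_isomorphic B C F F"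
proof -
  have F: "category B" "\<And>a. a \<in> Obj B \<Longrightarrow> OMap F a \<in> Obj C"
      "\<And>f a b. f \<in> Hom B a b \<Longrightarrow> AMap F f \<in> Hom C (OMap F a) (OMap F b)"
    using assms by (auto simp: is_functor_def)
  have "is_ntrans B C \<lparr>NSrc = F, NTgt = F, At = (\<lambda>a\<in>Obj B. Idt C (OMap F a))\<rparr>"
    unfolding is_ntrans_def using assms F(2) id_hom
    by (auto simp: homD[OF F(3)] category.homD[OF F(1)])
  then show ?thesis
    unfolding naturally_isomorphic_def using iso_id F(2) by fastforce
qed

lemma is_equivalence_id: "is_equivalence C C (id_functor C)"
proof -
  have "comp_functor C (id_functor C) (id_functor C) = id_functor C"
    by (auto simp: comp_functor_def id_functor_def compose_def)
  then show ?thesis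
    unfolding is_equivalence_def using is_functor_id naturally_isomorphic_refl by metis
qed

end

section \<open>Arithmetic in hom-groups\<close>

context preadditive_category
begin

lemma hom_group_simps [simp]:
  "carrier (hom_group C a b) = Hom C a b" "monoid.mult (hom_group C a b) = Add C"
  "one (hom_group C a b) = Zero C a b"
  by (auto simp: hom_group_def)

abbreviation (input) Neg :: "'o \<Rightarrow> 'o \<Rightarrow> 'm \<Rightarrow> 'm" where
  "Neg a b f \<equiv> inv\<^bsub>hom_group C a b\<^esub> f"

lemma add_hom: "\<lbrakk>f \<in> Hom C a b; g \<in> Hom C a b\<rbrakk> \<Longrightarrow> f \<oplus> g \<in> Hom C a b"
  using comm_groupE(1)[OF hom_comm_group, of a b f g] homD(4,5) by simp

lemma zero_hom: "\<lbrakk>a \<in> Obj C; b \<in> Obj C\<rbrakk> \<Longrightarrow> Zero C a b \<in> Hom C a b"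
  using comm_groupE(2)[OF hom_comm_group, of a b] by simp

lemma neg_hom: "f \<in> Hom C a b \<Longrightarrow> Neg a b f \<in> Hom C a b"
  using group.inv_closed[OF comm_group.axioms(2)[OF hom_comm_group, of a b], of f] homD(4,5) by simp

lemma sub_hom: "\<lbrakk>f \<in> Hom C a b; g \<in> Hom C a b\<rbrakk> \<Longrightarrow> f \<ominus> g \<in> Hom C a b"
  unfolding Sub_def using homD(2,3)[of g a b] by (simp add: add_hom neg_hom)

lemma add_assoc:
  "\<lbrakk>f \<in> Hom C a b; g \<in> Hom C a b; h \<in> Hom C a b\<rbrakk> \<Longrightarrow> f \<oplus> g \<oplus> h = f \<oplus> (g \<oplus> h)"
  using comm_groupE(3)[OF hom_comm_group, of a b f g h] homD(4,5) by simp

lemma add_commute: "\<lbrakk>f \<in> Hom C a b; g \<in> Hom C a b\<rbrakk> \<Longrightarrow> f \<oplus> g = g \<oplus> f"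
  using comm_groupE(4)[OF hom_comm_group, of a b f g] homD(4,5) by simp

lemma add_zero:
  assumes "f \<in> Hom C a b" shows "f \<oplus> Zero C a b = f" "Zero C a b \<oplus> f = f"
  using comm_groupE(5)[OF hom_comm_group, of a b f] assms homD(4,5)[OF assms]
    add_commute[OF assms zero_hom] by auto

lemma add_neg:
  assumes "f \<in> Hom C a b" shows "f \<oplus> Neg a b f = Zero C a b"
  using group.r_inv[OF comm_group.axioms(2)[OF hom_comm_group, of a b], of f] assms
    homD(4,5)[OF assms] by simp

lemma add_left_cancel:
  assumes "f \<in> Hom C a b" "g \<in> Hom C a b" "h \<in> Hom C a b" "f \<oplus> g = f \<oplus> h"
  shows "g = h"
  using group.right_cancel[OF comm_group.axioms(2)[OF hom_comm_group, of a b], of f g h] assms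
    homD(4,5)[OF assms(1)] add_commute[OF assms(1,2)] add_commute[OF assms(1,3)] by simp

text \<open>An idempotent of a group is neutral. Composition and tensor are only assumed to respect
  sums; that they respect zero is derived from this.\<close>

lemma add_self_zero: "\<lbrakk>f \<in> Hom C a b; f \<oplus> f = f\<rbrakk> \<Longrightarrow> f = Zero C a b"
  by (rule add_left_cancel[of f a b f]) (auto simp: add_zero zero_hom homD)

lemma zero_cmp:
  assumes "f \<in> Hom C a b" "c \<in> Obj C" shows "Zero C b c \<cdot> f = Zero C a c"
proof (rule add_self_zero)
  have z: "Zero C b c \<in> Hom C b c" using assms by (auto intro: zero_hom homD)
  show "Zero C b c \<cdot> f \<in> Hom C a c" using assms z by (auto intro: cmp_hom)
  show "Zero C b c \<cdot> f \<oplus> Zero C b c \<cdot> f = Zero C b c \<cdot> f"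
    using cmp_add_left[OF assms(1) z z] add_zero[OF z] by simp
qed

lemma cmp_zero:
  assumes "f \<in> Hom C b c" "a \<in> Obj C" shows "f \<cdot> Zero C a b = Zero C a c"
proof (rule add_self_zero)
  have z: "Zero C a b \<in> Hom C a b" using assms by (auto intro: zero_hom homD)
  show "f \<cdot> Zero C a b \<in> Hom C a c" using assms z by (auto intro: cmp_hom)
  show "f \<cdot> Zero C a b \<oplus> f \<cdot> Zero C a b = f \<cdot> Zero C a b"
    using cmp_add_right[OF z z assms(1)] add_zero[OF z] by simp
qed

text \<open>The two inverses are taken in different hom-groups. Both cancel
  \<open>h \<cdot> g\<close>, because \<open>h\<close> composed with zero is zero, so uniqueness of
  inverses identifies them.\<close>

lemma cmp_neg:
  assumes "g \<in> Hom C a b" "h \<in> Hom C b c"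
  shows "h \<cdot> Neg a b g = Neg a c (h \<cdot> g)"
proof (rule add_left_cancel)
  have n: "Neg a b g \<in> Hom C a b" by (rule neg_hom[OF assms(1)])
  show hg: "h \<cdot> g \<in> Hom C a c" by (rule cmp_hom[OF assms])
  show "h \<cdot> Neg a b g \<in> Hom C a c" by (rule cmp_hom[OF n assms(2)])
  show "Neg a c (h \<cdot> g) \<in> Hom C a c" by (rule neg_hom[OF hg])
  show "h \<cdot> g \<oplus> h \<cdot> Neg a b g = h \<cdot> g \<oplus> Neg a c (h \<cdot> g)"
    using cmp_add_right[OF assms(1) n assms(2)] add_neg[OF assms(1)] add_neg[OF hg]
      cmp_zero[OF assms(2) homD(4)[OF assms(1)]] by simp
qed

lemma cmp_sub:
  assumes "f \<in> Hom C a b" "g \<in> Hom C a b" "h \<in> Hom C b c"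
  shows "h \<cdot> (f \<ominus> g) = h \<cdot> f \<ominus> h \<cdot> g"
  unfolding Sub_def
  using cmp_add_right[OF assms(1) neg_hom[OF assms(2)] assms(3)] cmp_neg[OF assms(2,3)]
    homD(2,3)[OF assms(2)] homD(2,3)[OF cmp_hom[OF assms(2,3)]] by simp

section \<open>Additive endofunctors as a strict monoidal category\<close>

lemma additive_functorD:
  assumes "is_additive_functor C C F"
  shows "OMap F \<in> extensional (Obj C)" "AMap F \<in> extensional (Arr C)"
    "a \<in> Obj C \<Longrightarrow> OMap F a \<in> Obj C"
    "f \<in> Hom C a b \<Longrightarrow> AMap F f \<in> Hom C (OMap F a) (OMap F b)"
    "a \<in> Obj C \<Longrightarrow> AMap F (Idt C a) = Idt C (OMap F a)"
    "\<lbrakk>f \<in> Hom C a b; g \<in> Hom C b c\<rbrakk> \<Longrightarrow> AMap F (g \<cdot> f) = AMap F g \<cdot> AMap F f"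
    "\<lbrakk>f \<in> Hom C a b; g \<in> Hom C a b\<rbrakk> \<Longrightarrow> AMap F (f \<oplus> g) = AMap F f \<oplus> AMap F g"
  using assms by (auto simp: is_additive_functor_def is_functor_def PiE_def)

lemma comp_functor_simps [simp]:
  "a \<in> Obj C \<Longrightarrow> OMap (comp_functor C G F) a = OMap G (OMap F a)"
  "f \<in> Arr C \<Longrightarrow> AMap (comp_functor C G F) f = AMap G (AMap F f)"
  by (auto simp: comp_functor_def compose_def)

lemma additive_functor_comp:
  assumes F: "is_additive_functor C C F" and G: "is_additive_functor C C G"
  shows "is_additive_functor C C (comp_functor C G F)"
proof -
  note F' = additive_functorD[OF F] and G' = additive_functorD[OF G]
  have "OMap (comp_functor C G F) \<in> Obj C \<rightarrow>\<^sub>E Obj C"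
    "AMap (comp_functor C G F) \<in> extensional (Arr C)"
    using F'(3) G'(3) by (auto simp: comp_functor_def compose_def)
  moreover have "AMap (comp_functor C G F) f
      \<in> Hom C (OMap (comp_functor C G F) a) (OMap (comp_functor C G F) b)"
    if "f \<in> Hom C a b" for f a b
    using that homD[OF that] F'(4) G'(4) by simp
  moreover have "AMap (comp_functor C G F) (g \<cdot> f)
      = AMap (comp_functor C G F) g \<cdot> AMap (comp_functor C G F) f"
    if "f \<in> Hom C a b" "g \<in> Hom C b c" for f g a b c
    using homD[OF that(1)] homD[OF that(2)] F'(6)[OF that] G'(6)[OF F'(4)[OF that(1)] F'(4)[OF that(2)]]
    by simp
  moreover have "AMap (comp_functor C G F) (f \<oplus> g)
      = AMap (comp_functor C G F) f \<oplus> AMap (comp_functor C G F) g"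
    if "f \<in> Hom C a b" "g \<in> Hom C a b" for f g a b
    using homD[OF that(1)] homD[OF that(2)] homD[OF add_hom[OF that]] F'(7)[OF that]
      G'(7)[OF F'(4)[OF that(1)] F'(4)[OF that(2)]]
    by simp
  ultimately show ?thesis
    unfolding is_additive_functor_def is_functor_def
    using category_axioms F'(3,5) G'(5) by simp
qed

text \<open>Extensionality makes this an equality and not merely an isomorphism. The hypothesis on
  \<open>F\<close> keeps its values inside \<open>Obj C\<close> and \<open>Arr C\<close>, where the
  restriction built into the composite of \<open>H\<close> and \<open>G\<close> has no
  effect.\<close>

lemma comp_functor_assoc:
  assumes "is_additive_functor C C F"
  shows "comp_functor C (comp_functor C H G) F = comp_functor C H (comp_functor C G F)"
proof -
  have "AMap F f \<in> Arr C" if "f \<in> Arr C" for f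
    using additive_functorD(4)[OF assms hom_self[OF that]] homD by blast
  then show ?thesis
    using additive_functorD(3)[OF assms]
    by (auto simp: comp_functor_def compose_def restrict_def fun_eq_iff)
qed

lemma AddEnd_simps [simp]:
  "Obj (AddEnd C) = {F. is_additive_functor C C F}"
  "Src (AddEnd C) = NSrc" "Tgt (AddEnd C) = NTgt" "Idt (AddEnd C) = id_ntrans C"
  "Cmp (AddEnd C) \<theta> \<eta> = \<lparr>NSrc = NSrc \<eta>, NTgt = NTgt \<theta>, At = (\<lambda>a\<in>Obj C. At \<theta> a \<cdot> At \<eta> a)\<rparr>"
  "Add (AddEnd C) \<eta> \<theta> = \<lparr>NSrc = NSrc \<eta>, NTgt = NTgt \<eta>, At = (\<lambda>a\<in>Obj C. At \<eta> a \<oplus> At \<theta> a)\<rparr>"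
  "Zero (AddEnd C) F G
    = \<lparr>NSrc = F, NTgt = G, At = (\<lambda>a\<in>Obj C. Zero C (OMap F a) (OMap G a))\<rparr>"
  "TObj (AddEnd C) = comp_functor C"
  "Asc (AddEnd C) F G H = id_ntrans C (comp_functor C F (comp_functor C G H))"
  by (simp_all add: AddEnd_def)

lemma AddEnd_arr:
  "\<eta> \<in> Arr (AddEnd C) \<longleftrightarrow> is_ntrans C C \<eta> \<and> is_additive_functor C C (NSrc \<eta>)
    \<and> is_additive_functor C C (NTgt \<eta>)"
  by (simp add: AddEnd_def)

lemma AddEnd_tensor:
  "TArr (AddEnd C) \<eta> \<theta> = \<lparr>NSrc = comp_functor C (NSrc \<eta>) (NSrc \<theta>),
    NTgt = comp_functor C (NTgt \<eta>) (NTgt \<theta>),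
    At = (\<lambda>a\<in>Obj C. At \<eta> (OMap (NTgt \<theta>) a) \<cdot> AMap (NSrc \<eta>) (At \<theta> a))\<rparr>"
  by (simp add: AddEnd_def)

lemma AddEnd_hom:
  "\<eta> \<in> Hom (AddEnd C) F G \<longleftrightarrow> is_additive_functor C C F \<and> is_additive_functor C C G
    \<and> NSrc \<eta> = F \<and> NTgt \<eta> = G \<and> At \<eta> \<in> extensional (Obj C)
    \<and> (\<forall>a\<in>Obj C. At \<eta> a \<in> Hom C (OMap F a) (OMap G a))
    \<and> (\<forall>a b. \<forall>f\<in>Hom C a b. At \<eta> b \<cdot> AMap F f = AMap G f \<cdot> At \<eta> a)"
  by (auto simp: Hom_def[of "AddEnd C"] AddEnd_arr is_ntrans_def is_additive_functor_def)

lemma id_ntrans_simps [simp]: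
  "NSrc (id_ntrans C F) = F" "NTgt (id_ntrans C F) = F"
  "a \<in> Obj C \<Longrightarrow> At (id_ntrans C F) a = Idt C (OMap F a)"
  by (auto simp: id_ntrans_def)

lemma id_ntrans_hom:
  assumes "is_additive_functor C C F"
  shows "id_ntrans C F \<in> Hom (AddEnd C) F F"
  unfolding AddEnd_hom
  using assms additive_functorD(3,4)[OF assms] id_hom homD[OF additive_functorD(4)[OF assms]] homD(4,5)
  by (auto simp: id_ntrans_def)

text \<open>Evaluates the inverse constraint inside \<open>tens2\<close> over
  \<open>AddEnd C\<close>. Uniqueness is argued directly, without a category structure on
  \<open>AddEnd C\<close>: a candidate inverse equals its composite with the identity, which is the
  identity by the inverse law.\<close>

lemma Inv_id_ntrans:
  assumes F: "is_additive_functor C C F"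
  shows "Inv (AddEnd C) (id_ntrans C F) = id_ntrans C F"
  unfolding Inv_def
proof (rule the_equality)
  have "id_ntrans C F \<in> Arr (AddEnd C)"
    using id_ntrans_hom[OF F] by (simp add: Hom_def)
  then show "inverse_arrows (AddEnd C) (id_ntrans C F) (id_ntrans C F)"
    unfolding inverse_arrows_def using id_ntrans_hom[OF F] additive_functorD(3)[OF F]
    by (auto simp: id_ntrans_def fun_eq_iff restrict_def)
next
  fix \<eta> assume inv: "inverse_arrows (AddEnd C) (id_ntrans C F) \<eta>"
  then have \<eta>: "\<eta> \<in> Hom (AddEnd C) F F" by (simp add: inverse_arrows_def)
  have "\<eta> = Cmp (AddEnd C) \<eta> (id_ntrans C F)"
  proof (rule ntrans.equality)
    show "At \<eta> = At (Cmp (AddEnd C) \<eta> (id_ntrans C F))"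
    proof (rule extensionalityI[of _ "Obj C"])
      fix a assume "a \<in> Obj C"
      then show "At \<eta> a = At (Cmp (AddEnd C) \<eta> (id_ntrans C F)) a"
        using \<eta> homD[of "At \<eta> a" "OMap F a" "OMap F a"] by (simp add: AddEnd_hom)
    qed (use \<eta> in \<open>auto simp: AddEnd_hom\<close>)
  qed (use \<eta> in \<open>auto simp: AddEnd_hom\<close>)
  also have "\<dots> = id_ntrans C F"
    using inv by (simp add: inverse_arrows_def)
  finally show "\<eta> = id_ntrans C F" .
qed

text \<open>In horizontal composition with an identity transformation one of the two factors is an
  identity arrow and drops out; here it is the outer one, in \<open>whisker_right\<close> the
  functor applied to an identity.\<close>

lemma whisker_left:
  assumes F: "is_additive_functor C C F" and \<eta>: "\<eta> \<in> Hom (AddEnd C) G H"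
  shows "TArr (AddEnd C) (id_ntrans C F) \<eta>
    = \<lparr>NSrc = comp_functor C F G, NTgt = comp_functor C F H, At = (\<lambda>a\<in>Obj C. AMap F (At \<eta> a))\<rparr>"
proof -
  have "Idt C (OMap F (OMap H a)) \<cdot> AMap F (At \<eta> a) = AMap F (At \<eta> a)" if "a \<in> Obj C" for a
    using \<eta> that homD[OF additive_functorD(4)[OF F, of "At \<eta> a" "OMap G a" "OMap H a"]]
    by (simp add: AddEnd_hom)
  moreover have "OMap H a \<in> Obj C" if "a \<in> Obj C" for a
    using \<eta> additive_functorD(3) that by (auto simp: AddEnd_hom)
  ultimately show ?thesis
    using \<eta> by (auto simp: AddEnd_tensor AddEnd_hom intro!: restrict_ext)
qed

lemma whisker_right:
  assumes F: "is_additive_functor C C F" and \<eta>: "\<eta> \<in> Hom (AddEnd C) G H"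
  shows "TArr (AddEnd C) \<eta> (id_ntrans C F)
    = \<lparr>NSrc = comp_functor C G F, NTgt = comp_functor C H F, At = (\<lambda>a\<in>Obj C. At \<eta> (OMap F a))\<rparr>"
proof -
  have "At \<eta> (OMap F a) \<cdot> AMap G (Idt C (OMap F a)) = At \<eta> (OMap F a)" if "a \<in> Obj C" for a
    using \<eta> additive_functorD(3)[OF F that] additive_functorD(5)[of G "OMap F a"]
      homD[of "At \<eta> (OMap F a)" "OMap G (OMap F a)" "OMap H (OMap F a)"]
    by (simp add: AddEnd_hom)
  then show ?thesis
    using \<eta> by (auto simp: AddEnd_tensor AddEnd_hom intro!: restrict_ext)
qed

text \<open>The constraint is an identity, so only the whiskering by \<open>G\<close> is left;
  strict associativity aligns the bracketing of the source functor.\<close>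

lemma tens1_AddEnd:
  assumes F: "is_additive_functor C C F" and G: "is_additive_functor C C G"
    and \<eta>: "\<eta> \<in> Hom (AddEnd C) (comp_functor C F F) H"
  shows "tens1 (AddEnd C) G F \<eta> = \<lparr>NSrc = comp_functor C (comp_functor C G F) F,
    NTgt = comp_functor C G H, At = (\<lambda>a\<in>Obj C. AMap G (At \<eta> a))\<rparr>"
proof -
  have "AMap G (At \<eta> a) \<cdot> Idt C (OMap G (OMap F (OMap F a))) = AMap G (At \<eta> a)" if "a \<in> Obj C" for a
    using \<eta> that homD[OF additive_functorD(4)[OF G, of "At \<eta> a" "OMap F (OMap F a)" "OMap H a"]]
    by (simp add: AddEnd_hom)
  then show ?thesis
    unfolding tens1_def
    by (auto simp: whisker_left[OF G \<eta>] comp_functor_assoc[OF F] additive_functorD(3)[OF F]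
        intro!: restrict_ext)
qed

lemma tens2_AddEnd:
  assumes F: "is_additive_functor C C F" and G: "is_additive_functor C C G"
    and \<eta>: "\<eta> \<in> Hom (AddEnd C) (comp_functor C F F) (comp_functor C F F)"
  shows "tens2 (AddEnd C) G F \<eta> = \<lparr>NSrc = comp_functor C (comp_functor C G F) F,
    NTgt = comp_functor C (comp_functor C G F) F, At = (\<lambda>a\<in>Obj C. AMap G (At \<eta> a))\<rparr>"
proof -
  have "Idt C (OMap G (OMap F (OMap F a))) \<cdot> AMap G (At \<eta> a) \<cdot> Idt C (OMap G (OMap F (OMap F a)))
      = AMap G (At \<eta> a)" if "a \<in> Obj C" for a
    using \<eta> that
      homD[OF additive_functorD(4)[OF G, of "At \<eta> a" "OMap F (OMap F a)" "OMap F (OMap F a)"]]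
    by (simp add: AddEnd_hom)
  moreover have "Inv (AddEnd C) (id_ntrans C (comp_functor C G (comp_functor C F F)))
      = id_ntrans C (comp_functor C G (comp_functor C F F))"
    by (intro Inv_id_ntrans additive_functor_comp F G)
  ultimately show ?thesis
    unfolding tens2_def
    by (auto simp: whisker_left[OF G \<eta>] comp_functor_assoc[OF F] additive_functorD(3)[OF F]
        intro!: restrict_ext)
qed

end

section \<open>Tensor calculus and naturality of the structure maps\<close>

context additive_monoidal_category
begin

lemma arr_tensor [simp]:
  assumes "f \<in> Arr C" "g \<in> Arr C"
  shows "f \<boxtimes> g \<in> Arr C" "Src C (f \<boxtimes> g) = Src C f \<odot> Src C g" "Tgt C (f \<boxtimes> g) = Tgt C f \<odot> Tgt C g"
  using homD[OF tensor_hom[OF hom_self[OF assms(1)] hom_self[OF assms(2)]]] by auto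

lemma arr_asc [simp]:
  assumes "a \<in> Obj C" "b \<in> Obj C" "c \<in> Obj C"
  shows "Asc C a b c \<in> Arr C" "Src C (Asc C a b c) = (a \<odot> b) \<odot> c" "Tgt C (Asc C a b c) = a \<odot> (b \<odot> c)"
  using homD[OF asc_hom[OF assms]] by auto

declare tensor_obj [simp] asc_iso [simp] src_obj [simp] tgt_obj [simp] tensor_id [simp]

lemma tensor_interchange:
  "\<lbrakk>f \<in> Arr C; g \<in> Arr C; f' \<in> Arr C; g' \<in> Arr C; Src C g = Tgt C f; Src C g' = Tgt C f'\<rbrakk>
    \<Longrightarrow> (g \<boxtimes> g') \<cdot> (f \<boxtimes> f') = (g \<cdot> f) \<boxtimes> (g' \<cdot> f')"
  using tensor_cmp[of f "Src C f" "Tgt C f" g "Tgt C g" f' "Src C f'" "Tgt C f'" g' "Tgt C g'"]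
  by (simp add: Hom_def)

lemma arr_asc_natural:
  "\<lbrakk>f \<in> Arr C; g \<in> Arr C; h \<in> Arr C\<rbrakk> \<Longrightarrow>
    Asc C (Tgt C f) (Tgt C g) (Tgt C h) \<cdot> ((f \<boxtimes> g) \<boxtimes> h)
      = (f \<boxtimes> (g \<boxtimes> h)) \<cdot> Asc C (Src C f) (Src C g) (Src C h)"
  using asc_natural[OF hom_self hom_self hom_self] by simp

lemma iso_tensor:
  assumes "is_iso C f" "is_iso C g" shows "is_iso C (f \<boxtimes> g)"
proof (rule isoI)
  note [simp] = iso_arr[OF assms(1)] iso_arr[OF assms(2)] assms
  show "f \<boxtimes> g \<in> Hom C (Src C f \<odot> Src C g) (Tgt C f \<odot> Tgt C g)"
    "Inv C f \<boxtimes> Inv C g \<in> Hom C (Tgt C f \<odot> Tgt C g) (Src C f \<odot> Src C g)"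
    by (auto intro!: homI)
  show "(Inv C f \<boxtimes> Inv C g) \<cdot> (f \<boxtimes> g) = Idt C (Src C f \<odot> Src C g)"
    "(f \<boxtimes> g) \<cdot> (Inv C f \<boxtimes> Inv C g) = Idt C (Tgt C f \<odot> Tgt C g)"
    by (simp_all add: tensor_interchange)
qed

lemma tens2_hom:
  assumes "M \<in> Obj C" "L \<in> Obj C" "c \<in> Hom C (L \<odot> L) (L \<odot> L)"
  shows "tens2 C M L c \<in> Hom C ((M \<odot> L) \<odot> L) ((M \<odot> L) \<odot> L)"
  unfolding tens2_def using assms homD[OF assms(3)] by (auto intro!: homI)

lemma tens1_hom:
  assumes "M \<in> Obj C" "L \<in> Obj C" "m \<in> Hom C (L \<odot> L) L"
  shows "tens1 C M L m \<in> Hom C ((M \<odot> L) \<odot> L) (M \<odot> L)"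
  unfolding tens1_def using assms homD[OF assms(3)] by (auto intro!: homI)

lemma asc_tens2:
  assumes "M \<in> Obj C" "L \<in> Obj C" "c \<in> Hom C (L \<odot> L) (L \<odot> L)"
  shows "Asc C M L L \<cdot> tens2 C M L c = (Idt C M \<boxtimes> c) \<cdot> Asc C M L L"
proof -
  note [simp] = assms(1,2) homD[OF assms(3)]
  have "Asc C M L L \<cdot> tens2 C M L c
      = (Asc C M L L \<cdot> Inv C (Asc C M L L)) \<cdot> ((Idt C M \<boxtimes> c) \<cdot> Asc C M L L)"
    unfolding tens2_def by (simp add: arr_assoc del: iso_Inv(4,5))
  then show ?thesis by simp
qed

text \<open>Cancelling \<open>Asc\<close> removes the inverse in \<open>tens2\<close>. Naturality of
  \<open>Asc\<close> turns the two tensorings with L into one with \<open>L \<odot> L\<close>, and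
  then \<open>f\<close> and \<open>c\<close> act on different factors and commute by interchange.
  This is the naturality of \<lambda>.\<close>

lemma tens2_natural:
  assumes "f \<in> Hom C M N" "L \<in> Obj C" "c \<in> Hom C (L \<odot> L) (L \<odot> L)"
  shows "tens2 C N L c \<cdot> ((f \<boxtimes> Idt C L) \<boxtimes> Idt C L) = ((f \<boxtimes> Idt C L) \<boxtimes> Idt C L) \<cdot> tens2 C M L c"
proof (rule iso_mono[of "Asc C N L L"])
  note [simp] = homD[OF assms(1)] assms(2) homD[OF assms(3)]
    homD[OF tens2_hom[OF homD(4)[OF assms(1)] assms(2,3)]]
    homD[OF tens2_hom[OF homD(5)[OF assms(1)] assms(2,3)]]
  have nat: "Asc C N L L \<cdot> ((f \<boxtimes> Idt C L) \<boxtimes> Idt C L) = (f \<boxtimes> Idt C (L \<odot> L)) \<cdot> Asc C M L L"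
    using arr_asc_natural[of f "Idt C L" "Idt C L"] by simp
  have "Asc C N L L \<cdot> (tens2 C N L c \<cdot> ((f \<boxtimes> Idt C L) \<boxtimes> Idt C L))
      = (Asc C N L L \<cdot> tens2 C N L c) \<cdot> ((f \<boxtimes> Idt C L) \<boxtimes> Idt C L)"
    by (simp add: arr_assoc)
  also have "\<dots> = (Idt C N \<boxtimes> c) \<cdot> (Asc C N L L \<cdot> ((f \<boxtimes> Idt C L) \<boxtimes> Idt C L))"
    using assms by (simp add: asc_tens2 arr_assoc)
  also have "\<dots> = ((Idt C N \<boxtimes> c) \<cdot> (f \<boxtimes> Idt C (L \<odot> L))) \<cdot> Asc C M L L"
    by (simp add: nat arr_assoc)
  also have "\<dots> = ((f \<boxtimes> Idt C (L \<odot> L)) \<cdot> (Idt C M \<boxtimes> c)) \<cdot> Asc C M L L"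
    by (simp add: tensor_interchange)
  also have "\<dots> = (f \<boxtimes> Idt C (L \<odot> L)) \<cdot> (Asc C M L L \<cdot> tens2 C M L c)"
    using assms by (simp add: asc_tens2 arr_assoc)
  also have "\<dots> = (Asc C N L L \<cdot> ((f \<boxtimes> Idt C L) \<boxtimes> Idt C L)) \<cdot> tens2 C M L c"
    unfolding nat by (simp add: arr_assoc)
  finally show "Asc C N L L \<cdot> (tens2 C N L c \<cdot> ((f \<boxtimes> Idt C L) \<boxtimes> Idt C L))
      = Asc C N L L \<cdot> (((f \<boxtimes> Idt C L) \<boxtimes> Idt C L) \<cdot> tens2 C M L c)"
    by (simp add: arr_assoc)
qed (use assms homD[OF assms(1)] homD[OF tens2_hom[OF homD(4)[OF assms(1)] assms(2,3)]]
    homD[OF tens2_hom[OF homD(5)[OF assms(1)] assms(2,3)]] in auto)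

lemma tens1_natural:
  assumes "f \<in> Hom C M N" "L \<in> Obj C" "m \<in> Hom C (L \<odot> L) L"
  shows "tens1 C N L m \<cdot> ((f \<boxtimes> Idt C L) \<boxtimes> Idt C L) = (f \<boxtimes> Idt C L) \<cdot> tens1 C M L m"
proof -
  note [simp] = homD[OF assms(1)] assms(2) homD[OF assms(3)]
  have nat: "Asc C N L L \<cdot> ((f \<boxtimes> Idt C L) \<boxtimes> Idt C L) = (f \<boxtimes> Idt C (L \<odot> L)) \<cdot> Asc C M L L"
    using arr_asc_natural[of f "Idt C L" "Idt C L"] by simp
  have "tens1 C N L m \<cdot> ((f \<boxtimes> Idt C L) \<boxtimes> Idt C L)
      = ((Idt C N \<boxtimes> m) \<cdot> (f \<boxtimes> Idt C (L \<odot> L))) \<cdot> Asc C M L L"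
    unfolding tens1_def by (simp add: nat arr_assoc)
  also have "\<dots> = ((f \<boxtimes> Idt C L) \<cdot> (Idt C M \<boxtimes> m)) \<cdot> Asc C M L L"
    by (simp add: tensor_interchange)
  finally show ?thesis unfolding tens1_def by (simp add: arr_assoc)
qed

text \<open>\<open>lifts M \<alpha> \<beta> g f\<close> says that \<open>g\<close> is \<open>M \<otimes> f\<close> up to the rebracketings \<open>\<alpha>\<close> and \<open>\<beta>\<close>
  of its source and target.\<close>

definition lifts :: "'o \<Rightarrow> 'm \<Rightarrow> 'm \<Rightarrow> 'm \<Rightarrow> 'm \<Rightarrow> bool" where
  "lifts M \<alpha> \<beta> g f \<longleftrightarrow> M \<in> Obj C \<and> is_iso C \<alpha> \<and> is_iso C \<beta> \<and> f \<in> Arr C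
     \<and> g \<in> Hom C (Src C \<alpha>) (Src C \<beta>) \<and> Tgt C \<alpha> = M \<odot> Src C f \<and> Tgt C \<beta> = M \<odot> Tgt C f
     \<and> \<beta> \<cdot> g = (Idt C M \<boxtimes> f) \<cdot> \<alpha>"

text \<open>Since \<open>\<beta>\<close> is invertible, the square determines its upper edge. To
  prove an equation at M it therefore suffices that both sides lift the same morphism between powers
  of L.\<close>

lemma lifts_unique: "\<lbrakk>lifts M \<alpha> \<beta> g f; lifts M \<alpha> \<beta> h f\<rbrakk> \<Longrightarrow> g = h"
  by (rule iso_mono[of \<beta>]) (auto simp: lifts_def Hom_def)

text \<open>Two squares sharing the side \<open>\<beta>\<close> are pasted.\<close>

lemma lifts_cmp:
  assumes "lifts M \<alpha> \<beta> g f" "lifts M \<beta> \<gamma> g' f'" "Src C f' = Tgt C f"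
  shows "lifts M \<alpha> \<gamma> (g' \<cdot> g) (f' \<cdot> f)"
proof -
  have [simp]: "M \<in> Obj C" "is_iso C \<alpha>" "is_iso C \<beta>" "is_iso C \<gamma>" "\<alpha> \<in> Arr C" "\<beta> \<in> Arr C" "\<gamma> \<in> Arr C"
    "f \<in> Arr C" "f' \<in> Arr C" "g \<in> Arr C" "g' \<in> Arr C" "Src C g = Src C \<alpha>" "Tgt C g = Src C \<beta>"
    "Src C g' = Src C \<beta>" "Tgt C g' = Src C \<gamma>" "Tgt C \<alpha> = M \<odot> Src C f" "Tgt C \<beta> = M \<odot> Tgt C f"
    "Tgt C \<gamma> = M \<odot> Tgt C f'" "Src C f' = Tgt C f"
    using assms by (auto simp: lifts_def Hom_def iso_arr)
  have eq: "\<beta> \<cdot> g = (Idt C M \<boxtimes> f) \<cdot> \<alpha>" "\<gamma> \<cdot> g' = (Idt C M \<boxtimes> f') \<cdot> \<beta>"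
    using assms by (auto simp: lifts_def)
  have "\<gamma> \<cdot> (g' \<cdot> g) = (\<gamma> \<cdot> g') \<cdot> g" by (simp add: arr_assoc)
  also have "\<dots> = (Idt C M \<boxtimes> f') \<cdot> (\<beta> \<cdot> g)" unfolding eq(2) by (simp add: arr_assoc)
  also have "\<dots> = ((Idt C M \<boxtimes> f') \<cdot> (Idt C M \<boxtimes> f)) \<cdot> \<alpha>" unfolding eq(1) by (simp add: arr_assoc)
  also have "\<dots> = (Idt C M \<boxtimes> (f' \<cdot> f)) \<cdot> \<alpha>" by (simp add: tensor_interchange)
  finally show ?thesis by (auto simp: lifts_def intro!: homI)
qed

lemma lifts_add:
  assumes "lifts M \<alpha> \<beta> g f" "lifts M \<alpha> \<beta> g' f'" "Src C f' = Src C f" "Tgt C f' = Tgt C f"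
  shows "lifts M \<alpha> \<beta> (g \<oplus> g') (f \<oplus> f')"
proof -
  let ?s = "Src C f" and ?t = "Tgt C f"
  have f: "f \<in> Hom C ?s ?t" "f' \<in> Hom C ?s ?t" and M: "Idt C M \<in> Hom C M M"
    and g: "g \<in> Hom C (Src C \<alpha>) (Src C \<beta>)" "g' \<in> Hom C (Src C \<alpha>) (Src C \<beta>)"
    and \<alpha>: "\<alpha> \<in> Hom C (Src C \<alpha>) (M \<odot> ?s)" and \<beta>: "\<beta> \<in> Hom C (Src C \<beta>) (M \<odot> ?t)"
    using assms by (auto simp: lifts_def Hom_def iso_arr)
  have "\<beta> \<cdot> (g \<oplus> g') = (Idt C M \<boxtimes> f) \<cdot> \<alpha> \<oplus> (Idt C M \<boxtimes> f') \<cdot> \<alpha>"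
    using cmp_add_right[OF g \<beta>] assms by (simp add: lifts_def)
  also have "\<dots> = (Idt C M \<boxtimes> (f \<oplus> f')) \<cdot> \<alpha>"
    using cmp_add_left[OF \<alpha> tensor_hom[OF M f(1)] tensor_hom[OF M f(2)]] tensor_add_right[OF f M]
    by simp
  finally show ?thesis
    using assms add_hom[OF g] homD[OF add_hom[OF f]] by (auto simp: lifts_def)
qed

lemma tensor_zero:
  assumes "M \<in> Obj C" "a \<in> Obj C" "b \<in> Obj C"
  shows "Idt C M \<boxtimes> Zero C a b = Zero C (M \<odot> a) (M \<odot> b)"
proof (rule add_self_zero)
  have z: "Zero C a b \<in> Hom C a b" using assms by (simp add: zero_hom)
  show "Idt C M \<boxtimes> Zero C a b \<in> Hom C (M \<odot> a) (M \<odot> b)"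
    by (rule tensor_hom[OF id_hom[OF assms(1)] z])
  show "Idt C M \<boxtimes> Zero C a b \<oplus> Idt C M \<boxtimes> Zero C a b = Idt C M \<boxtimes> Zero C a b"
    using tensor_add_right[OF z z id_hom[OF assms(1)]] add_zero[OF z] by simp
qed

lemma lifts_zero:
  assumes "M \<in> Obj C" "is_iso C \<alpha>" "is_iso C \<beta>" "a \<in> Obj C" "b \<in> Obj C"
    "Tgt C \<alpha> = M \<odot> a" "Tgt C \<beta> = M \<odot> b"
  shows "lifts M \<alpha> \<beta> (Zero C (Src C \<alpha>) (Src C \<beta>)) (Zero C a b)"
proof -
  have "\<beta> \<cdot> Zero C (Src C \<alpha>) (Src C \<beta>) = Zero C (Src C \<alpha>) (M \<odot> b)"
    using cmp_zero[OF hom_self] assms by (simp add: iso_arr)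
  moreover have "Zero C (M \<odot> a) (M \<odot> b) \<cdot> \<alpha> = Zero C (Src C \<alpha>) (M \<odot> b)"
    using zero_cmp[OF hom_self, of \<alpha> "M \<odot> b"] assms by (simp add: iso_arr)
  ultimately show ?thesis
    using assms homD[OF zero_hom[OF assms(4,5)]] zero_hom[of "Src C \<alpha>" "Src C \<beta>"]
    by (simp add: lifts_def tensor_zero iso_arr)
qed

lemma lifts_id:
  assumes "M \<in> Obj C" "a \<in> Obj C" "is_iso C \<alpha>" "Tgt C \<alpha> = M \<odot> a"
  shows "lifts M \<alpha> \<alpha> (Idt C (Src C \<alpha>)) (Idt C a)"
  using assms by (auto simp: lifts_def iso_arr intro!: id_hom)

section \<open>Rebracketing with three copies of L\<close>

text \<open>Of the possible rebracketings, this one ends in the left-bracketed cube of L, on which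
  \<open>tperm\<close> and \<open>wperm\<close> act.\<close>

definition asc3 :: "'o \<Rightarrow> 'o \<Rightarrow> 'm" where
  "asc3 M L = Asc C M (L \<odot> L) L \<cdot> (Asc C M L L \<boxtimes> Idt C L)"

lemma asc3 [simp]:
  assumes "M \<in> Obj C" "L \<in> Obj C"
  shows "asc3 M L \<in> Arr C" "Src C (asc3 M L) = ((M \<odot> L) \<odot> L) \<odot> L"
    "Tgt C (asc3 M L) = M \<odot> ((L \<odot> L) \<odot> L)" "is_iso C (asc3 M L)"
  using assms by (auto simp: asc3_def intro!: iso_cmp iso_tensor iso_id)

lemma asc3_pentagon:
  assumes "M \<in> Obj C" "L \<in> Obj C"
  shows "Asc C M L (L \<odot> L) \<cdot> Asc C (M \<odot> L) L L = (Idt C M \<boxtimes> Asc C L L L) \<cdot> asc3 M L"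
  using assms by (simp add: asc3_def pentagon arr_assoc)

lemma lifts_tens2:
  assumes "M \<in> Obj C" "L \<in> Obj C" "c \<in> Hom C (L \<odot> L) (L \<odot> L)"
  shows "lifts M (Asc C M L L) (Asc C M L L) (tens2 C M L c) c"
  using assms tens2_hom[OF assms] homD[OF assms(3)] by (simp add: lifts_def asc_tens2)

lemma lifts_tens1:
  assumes "M \<in> Obj C" "L \<in> Obj C" "m \<in> Hom C (L \<odot> L) L"
  shows "lifts M (Asc C M L L) (Idt C (M \<odot> L)) (tens1 C M L m) m"
  using assms tens1_hom[OF assms] homD[OF assms(3)] by (simp add: lifts_def iso_id tens1_def)

text \<open>Tensor the square with L, then use naturality of \<open>Asc\<close> to move the factor M
  out of the bracket. The side \<open>\<beta>\<close> stays general because it is \<open>Asc\<close>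
  for an operator on \<open>L \<odot> L\<close> and an identity for a bracket.\<close>

lemma lifts_tensor_right:
  assumes "lifts M (Asc C M L L) \<beta> g f" "L \<in> Obj C" "Src C f = L \<odot> L"
  shows "lifts M (asc3 M L) (Asc C M (Tgt C f) L \<cdot> (\<beta> \<boxtimes> Idt C L)) (g \<boxtimes> Idt C L) (f \<boxtimes> Idt C L)"
proof -
  have [simp]: "M \<in> Obj C" "is_iso C \<beta>" "\<beta> \<in> Arr C" "f \<in> Arr C" "g \<in> Arr C" "L \<in> Obj C"
    "Src C g = (M \<odot> L) \<odot> L" "Tgt C g = Src C \<beta>" "Tgt C \<beta> = M \<odot> Tgt C f" "Src C f = L \<odot> L"
    using assms by (auto simp: lifts_def Hom_def iso_arr)
  have eq: "\<beta> \<cdot> g = (Idt C M \<boxtimes> f) \<cdot> Asc C M L L"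
    using assms by (simp add: lifts_def)
  have nat: "Asc C M (Tgt C f) L \<cdot> ((Idt C M \<boxtimes> f) \<boxtimes> Idt C L)
      = (Idt C M \<boxtimes> (f \<boxtimes> Idt C L)) \<cdot> Asc C M (L \<odot> L) L"
    using arr_asc_natural[of "Idt C M" f "Idt C L"] by simp
  have "(Asc C M (Tgt C f) L \<cdot> (\<beta> \<boxtimes> Idt C L)) \<cdot> (g \<boxtimes> Idt C L)
      = Asc C M (Tgt C f) L \<cdot> ((\<beta> \<cdot> g) \<boxtimes> Idt C L)"
    by (simp add: arr_assoc tensor_interchange)
  also have "\<dots> = Asc C M (Tgt C f) L \<cdot> (((Idt C M \<boxtimes> f) \<boxtimes> Idt C L) \<cdot> (Asc C M L L \<boxtimes> Idt C L))"
    unfolding eq by (simp add: tensor_interchange)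
  also have "\<dots> = (Asc C M (Tgt C f) L \<cdot> ((Idt C M \<boxtimes> f) \<boxtimes> Idt C L)) \<cdot> (Asc C M L L \<boxtimes> Idt C L)"
    by (simp add: arr_assoc)
  also have "\<dots> = (Idt C M \<boxtimes> (f \<boxtimes> Idt C L)) \<cdot> asc3 M L"
    unfolding nat asc3_def by (simp add: arr_assoc)
  finally show ?thesis
    by (auto simp: lifts_def intro!: homI iso_cmp iso_tensor iso_id)
qed

lemma lifts_tens2_right:
  assumes "M \<in> Obj C" "L \<in> Obj C" "c \<in> Hom C (L \<odot> L) (L \<odot> L)"
  shows "lifts M (asc3 M L) (asc3 M L) (tens2 C M L c \<boxtimes> Idt C L) (c \<boxtimes> Idt C L)"
  using lifts_tensor_right[OF lifts_tens2[OF assms]] assms homD[OF assms(3)]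
  by (simp add: asc3_def)

lemma lifts_tens1_right:
  assumes "M \<in> Obj C" "L \<in> Obj C" "m \<in> Hom C (L \<odot> L) L"
  shows "lifts M (asc3 M L) (Asc C M L L) (tens1 C M L m \<boxtimes> Idt C L) (m \<boxtimes> Idt C L)"
  using lifts_tensor_right[OF lifts_tens1[OF assms]] assms homD[OF assms(3)] by simp

text \<open>Here M and the first L are inert. Naturality of \<open>Asc\<close> splits
  \<open>M \<odot> L\<close> into its two factors, and the pentagon reconciles the resulting path
  with \<open>asc3\<close>.\<close>

lemma lifts_tens1_left:
  assumes "M \<in> Obj C" "L \<in> Obj C" "m \<in> Hom C (L \<odot> L) L"
  shows "lifts M (asc3 M L) (Asc C M L L) (tens1 C (M \<odot> L) L m) (tens1 C L L m)"
proof -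
  note [simp] = assms(1,2) homD[OF assms(3)]
  have nat: "Asc C M L L \<cdot> (Idt C (M \<odot> L) \<boxtimes> m) = (Idt C M \<boxtimes> (Idt C L \<boxtimes> m)) \<cdot> Asc C M L (L \<odot> L)"
    using arr_asc_natural[of "Idt C M" "Idt C L" m] by simp
  have "Asc C M L L \<cdot> tens1 C (M \<odot> L) L m
      = (Asc C M L L \<cdot> (Idt C (M \<odot> L) \<boxtimes> m)) \<cdot> Asc C (M \<odot> L) L L"
    unfolding tens1_def by (simp add: arr_assoc)
  also have "\<dots> = (Idt C M \<boxtimes> (Idt C L \<boxtimes> m)) \<cdot> (Asc C M L (L \<odot> L) \<cdot> Asc C (M \<odot> L) L L)"
    unfolding nat by (simp add: arr_assoc)
  also have "\<dots> = ((Idt C M \<boxtimes> (Idt C L \<boxtimes> m)) \<cdot> (Idt C M \<boxtimes> Asc C L L L)) \<cdot> asc3 M L"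
    by (simp add: asc3_pentagon arr_assoc)
  also have "\<dots> = (Idt C M \<boxtimes> tens1 C L L m) \<cdot> asc3 M L"
    by (simp add: tensor_interchange tens1_def)
  finally show ?thesis
    using homD[OF tens1_hom[of "M \<odot> L" L m]] homD[OF tens1_hom[of L L m]] assms(3)
    by (auto simp: lifts_def intro!: homI)
qed

text \<open>As for \<open>tens1\<close>, except that \<open>tens2\<close> also contains an inverse
  constraint; the square is checked after composing with the isomorphism \<open>?A\<close>, which
  absorbs it.\<close>

lemma lifts_tens2_left:
  assumes "M \<in> Obj C" "L \<in> Obj C" "c \<in> Hom C (L \<odot> L) (L \<odot> L)"
  shows "lifts M (asc3 M L) (asc3 M L) (tens2 C (M \<odot> L) L c) (tens2 C L L c)"
proof -
  have obj: "M \<odot> L \<in> Obj C" using assms by simp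
  note [simp] = assms(1,2) homD[OF assms(3)] homD[OF tens2_hom[OF obj assms(2,3)]]
    homD[OF tens2_hom[OF assms(2,2,3)]]
  let ?A = "Idt C M \<boxtimes> Asc C L L L"
  let ?P = "Asc C M L (L \<odot> L) \<cdot> Asc C (M \<odot> L) L L"
  have nat: "Asc C M L (L \<odot> L) \<cdot> (Idt C (M \<odot> L) \<boxtimes> c)
      = (Idt C M \<boxtimes> (Idt C L \<boxtimes> c)) \<cdot> Asc C M L (L \<odot> L)"
    using arr_asc_natural[of "Idt C M" "Idt C L" c] by simp
  have eq: "asc3 M L \<cdot> tens2 C (M \<odot> L) L c = (Idt C M \<boxtimes> tens2 C L L c) \<cdot> asc3 M L"
  proof (rule iso_mono[of ?A])
    have "?A \<cdot> (asc3 M L \<cdot> tens2 C (M \<odot> L) L c) = (?A \<cdot> asc3 M L) \<cdot> tens2 C (M \<odot> L) L c"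
      by (simp add: arr_assoc)
    also have "\<dots> = Asc C M L (L \<odot> L) \<cdot> (Asc C (M \<odot> L) L L \<cdot> tens2 C (M \<odot> L) L c)"
      by (simp add: asc3_pentagon[symmetric] arr_assoc)
    also have "\<dots> = (Asc C M L (L \<odot> L) \<cdot> (Idt C (M \<odot> L) \<boxtimes> c)) \<cdot> Asc C (M \<odot> L) L L"
      by (simp add: asc_tens2[OF obj assms(2,3)] arr_assoc)
    also have "\<dots> = (Idt C M \<boxtimes> (Idt C L \<boxtimes> c)) \<cdot> ?P"
      unfolding nat by (simp add: arr_assoc)
    also have "\<dots> = ((Idt C M \<boxtimes> (Idt C L \<boxtimes> c)) \<cdot> ?A) \<cdot> asc3 M L"
      by (simp add: asc3_pentagon arr_assoc)
    also have "\<dots> = (?A \<cdot> (Idt C M \<boxtimes> tens2 C L L c)) \<cdot> asc3 M L"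
      by (simp add: tensor_interchange asc_tens2[OF assms(2,2,3)])
    finally show "?A \<cdot> (asc3 M L \<cdot> tens2 C (M \<odot> L) L c)
        = ?A \<cdot> ((Idt C M \<boxtimes> tens2 C L L c) \<cdot> asc3 M L)"
      by (simp add: arr_assoc)
  qed (auto intro!: iso_tensor iso_id)
  then show ?thesis
    by (auto simp: lifts_def intro!: homI)
qed

text \<open>Both sides lift the identity of \<open>L \<odot> L\<close>. Besides the involution of
  the monad, the case M = L supplies an involution needed for the reversed axioms.\<close>

lemma tens2_involution:
  assumes "M \<in> Obj C" "L \<in> Obj C" "c \<in> Hom C (L \<odot> L) (L \<odot> L)" "c \<cdot> c = Idt C (L \<odot> L)"
  shows "tens2 C M L c \<cdot> tens2 C M L c = Idt C ((M \<odot> L) \<odot> L)"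
  using lifts_unique[OF lifts_cmp[OF lifts_tens2[OF assms(1-3)] lifts_tens2[OF assms(1-3)]]]
    lifts_id[of M "L \<odot> L" "Asc C M L L"] assms homD[OF assms(3)]
  by simp

section \<open>The YB-Lie axioms in reversed order\<close>

lemma yb_lie_algebra_hom:
  assumes "yb_lie_algebra C (L, lam, Lam)"
  shows "L \<in> Obj C" "lam \<in> Hom C (L \<odot> L) (L \<odot> L)" "lam \<cdot> lam = Idt C (L \<odot> L)"
    "Lam \<in> Hom C (L \<odot> L) L"
  using assms by (auto simp: symmetric_yang_baxter_def)

text \<open>The axioms survive reversing the tensor factors, which exchanges \<open>t\<close> and \<open>w\<close>:
  one has \<open>t\<^sup>2 = w\<close> and \<open>t w = 1\<close>, so \<open>t (1 + t + w) = 1 + t + w\<close>.\<close>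

lemma yb_lie_algebra_mirror:
  assumes "yb_lie_algebra C (L, lam, Lam)"
  shows "lam \<cdot> tens1 C L L Lam = (Lam \<boxtimes> Idt C L) \<cdot> wperm C L lam" (is ?hex)
    and "Lam \<cdot> (Lam \<boxtimes> Idt C L) \<cdot> (Idt C ((L \<odot> L) \<odot> L) \<oplus> wperm C L lam \<oplus> tperm C L lam)
      = Zero C ((L \<odot> L) \<odot> L) L" (is ?jacobi)
proof -
  let ?O = "(L \<odot> L) \<odot> L"
  define a b t w where "a = lam \<boxtimes> Idt C L" and "b = tens2 C L L lam"
    and "t = tperm C L lam" and "w = wperm C L lam"
  define P Q where "P = Lam \<boxtimes> Idt C L" and "Q = tens1 C L L Lam"
  note L = yb_lie_algebra_hom[OF assms]
  have hom: "a \<in> Hom C ?O ?O" "b \<in> Hom C ?O ?O" "P \<in> Hom C ?O (L \<odot> L)" "Q \<in> Hom C ?O (L \<odot> L)"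
    unfolding a_def b_def P_def Q_def using L
    by (auto intro!: tens2_hom tens1_hom tensor_hom id_hom)
  note [simp] = homD[OF hom(1)] homD[OF hom(2)] homD[OF hom(3)] homD[OF hom(4)]
    homD[OF L(2)] homD[OF L(4)] L(1)
  have t: "t = a \<cdot> b" and w: "w = b \<cdot> a"
    unfolding t_def w_def a_def b_def tperm_def wperm_def by auto
  have tw_hom: "t \<in> Hom C ?O ?O" "w \<in> Hom C ?O ?O"
    unfolding t w using hom cmp_hom by blast+
  note [simp] = homD[OF tw_hom(1)] homD[OF tw_hom(2)]
  have aa: "a \<cdot> a = Idt C ?O"
    unfolding a_def by (simp add: tensor_interchange L(3))
  have bb: "b \<cdot> b = Idt C ?O"
    unfolding b_def using L by (simp add: tens2_involution)
  have aba: "a \<cdot> b \<cdot> a = b \<cdot> a \<cdot> b"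
    using assms by (simp add: symmetric_yang_baxter_def a_def b_def)
  \<comment> \<open>The braid relation turns \<open>a b a b\<close> into \<open>b a b b\<close>, and
    \<open>b\<close> is an involution.\<close>
  have "t \<cdot> t = (a \<cdot> b \<cdot> a) \<cdot> b" unfolding t by (simp add: arr_assoc)
  also have "\<dots> = (b \<cdot> a) \<cdot> (b \<cdot> b)" unfolding aba by (simp add: arr_assoc)
  finally have tt: "t \<cdot> t = w" by (simp add: bb w)
  have "t \<cdot> w = a \<cdot> ((b \<cdot> b) \<cdot> a)" unfolding t w by (simp add: arr_assoc)
  then have tw: "t \<cdot> w = Idt C ?O" by (simp add: bb aa)
  have PQ: "lam \<cdot> P = Q \<cdot> t"
    using assms by (simp add: P_def Q_def t_def)
  \<comment> \<open>As \<open>t w = 1\<close>, the given \<open>lam P = Q t\<close> can be solved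
    for \<open>Q\<close>; composing with the involution \<open>lam\<close> then isolates
    \<open>P w\<close>.\<close>
  have "Q = (Q \<cdot> t) \<cdot> w" by (simp add: arr_assoc tw)
  also have "\<dots> = lam \<cdot> (P \<cdot> w)" unfolding PQ[symmetric] by (simp add: arr_assoc)
  finally have "lam \<cdot> Q = (lam \<cdot> lam) \<cdot> (P \<cdot> w)" by (simp add: arr_assoc del: L(3))
  then show ?hex by (simp add: L(3) P_def[symmetric] Q_def[symmetric] w_def[symmetric])

  let ?id = "Idt C ?O"
  define s where "s = ?id \<oplus> t \<oplus> w"
  have id: "?id \<in> Hom C ?O ?O" by (rule id_hom) simp
  have s: "s \<in> Hom C ?O ?O" unfolding s_def by (intro add_hom id tw_hom)
  have s': "?id \<oplus> w \<oplus> t = s"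
    unfolding s_def using add_assoc[OF id tw_hom] add_assoc[OF id tw_hom(2,1)] add_commute[OF tw_hom]
    by simp
  have "t \<cdot> s = t \<oplus> w \<oplus> ?id"
    unfolding s_def using cmp_add_right[OF add_hom[OF id tw_hom(1)] tw_hom(2) tw_hom(1)]
      cmp_add_right[OF id tw_hom(1) tw_hom(1)] by (simp add: tt tw)
  also have "\<dots> = s"
    unfolding s_def using add_commute[OF add_hom[OF tw_hom] id] add_assoc[OF id tw_hom] by simp
  finally have ts: "t \<cdot> s = s" .
  \<comment> \<open>By antisymmetry \<open>Lam P = - Lam lam P = - Lam Q t\<close>. After
    composition with \<open>s\<close> the factor \<open>t\<close> is absorbed, and the given Jacobi
    identity makes the result vanish.\<close>
  have anti: "Lam \<oplus> Lam \<cdot> lam = Zero C (L \<odot> L) L"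
    using assms cmp_add_right[OF id_hom L(2) L(4)] by simp
  have LamP: "Lam \<cdot> P \<in> Hom C ?O L" and LamQ: "Lam \<cdot> Q \<in> Hom C ?O L"
    and Lamlam: "Lam \<cdot> lam \<in> Hom C (L \<odot> L) L"
    using hom L cmp_hom by blast+
  have LamQt: "(Lam \<cdot> Q) \<cdot> t \<in> Hom C ?O L" by (rule cmp_hom[OF tw_hom(1) LamQ])
  have "Lam \<cdot> P \<oplus> (Lam \<cdot> lam) \<cdot> P = Zero C ?O L"
    using cmp_add_left[OF hom(3) L(4) Lamlam] anti zero_cmp[OF hom(3) L(1)] by simp
  moreover have "(Lam \<cdot> lam) \<cdot> P = (Lam \<cdot> Q) \<cdot> t" by (simp add: arr_assoc PQ)
  ultimately have sum: "Lam \<cdot> P \<oplus> (Lam \<cdot> Q) \<cdot> t = Zero C ?O L" by simp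
  have "(Lam \<cdot> Q) \<cdot> s = Zero C ?O L"
    using assms by (simp add: Q_def s_def t_def w_def)
  then have "((Lam \<cdot> Q) \<cdot> t) \<cdot> s = Zero C ?O L"
    using homD[OF s] homD[OF LamQ] by (simp add: arr_assoc[of s t] ts)
  then have "(Lam \<cdot> P) \<cdot> s = Zero C ?O L"
    using cmp_add_left[OF s LamP LamQt] zero_cmp[OF s L(1)] add_zero[OF cmp_hom[OF s LamP]]
    by (simp add: sum)
  then show ?jacobi by (simp add: P_def s' w_def[symmetric] t_def[symmetric])
qed

section \<open>The two categories of modules coincide\<close>

lemma LieMod_eq_EML:
  assumes "yb_lie_algebra C (L, lam, Lam)"
  shows "LieMod C (L, lam, Lam) = EML C (Mnd C (L, lam, Lam))"
proof -
  note L = yb_lie_algebra_hom[OF assms]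
  have obj: "is_lie_module C (L, lam, Lam) (X, \<rho>) \<longleftrightarrow> is_eml_object C (Mnd C (L, lam, Lam)) (X, \<rho>)"
    if X: "X \<in> Obj C" and \<rho>: "\<rho> \<in> Hom C (X \<odot> L) X" for X \<rho>
  proof -
    let ?P = "\<rho> \<boxtimes> Idt C L" and ?T = "tens2 C X L lam" and ?m = "tens1 C X L Lam"
    let ?O = "(X \<odot> L) \<odot> L"
    have P: "?P \<in> Hom C ?O (X \<odot> L)" by (rule tensor_hom[OF \<rho> id_hom[OF L(1)]])
    have T: "?T \<in> Hom C ?O ?O" and m: "?m \<in> Hom C ?O (X \<odot> L)" and id: "Idt C ?O \<in> Hom C ?O ?O"
      using X L by (auto intro!: tens2_hom tens1_hom id_hom)
    have PT: "?P \<cdot> ?T \<in> Hom C ?O (X \<odot> L)" and \<rho>P: "\<rho> \<cdot> ?P \<in> Hom C ?O X"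
      using P T \<rho> cmp_hom by blast+
    \<comment> \<open>Differences associate to the left, so both defining expressions expand to the
      same three-term difference.\<close>
    have "\<rho> \<cdot> (?P \<ominus> ?P \<cdot> ?T \<ominus> ?m) = \<rho> \<cdot> ?P \<ominus> \<rho> \<cdot> (?P \<cdot> ?T) \<ominus> \<rho> \<cdot> ?m"
      using cmp_sub[OF sub_hom[OF P PT] m \<rho>] cmp_sub[OF P PT \<rho>] by simp
    also have "\<dots> = \<rho> \<cdot> ?P \<cdot> (Idt C ?O \<ominus> ?T) \<ominus> \<rho> \<cdot> ?m"
      using cmp_sub[OF id T \<rho>P] id_right[OF \<rho>P] cmp_assoc[OF T P \<rho>] by simp
    finally show ?thesis
      using X \<rho> L(1) homD[OF \<rho>] by (simp add: tensor_functor_def Let_def)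
  qed
  have S: "{M. is_lie_module C (L, lam, Lam) M} = {M. is_eml_object C (Mnd C (L, lam, Lam)) M}"
    using obj by (auto simp: tensor_functor_def Let_def)
  \<comment> \<open>The restriction to arrows is essential: \<open>AMap\<close> of
    \<open>tensor_functor\<close> is a tensor product only there. Both categories require their
    morphisms to be arrows of C.\<close>
  have mor: "lie_module_morphism C (L, lam, Lam) M N f \<longleftrightarrow> eml_morphism C (Mnd C (L, lam, Lam)) M N f"
    if "f \<in> Arr C" for M N f
    using that by (cases M; cases N) (simp add: tensor_functor_def Let_def)
  show ?thesis
    unfolding LieMod_def EML_def S structured_cat_def using mor by (auto simp: Hom_def)
qed

text \<open>An equivalence presupposes categories at both ends; by the equality above this one check
  serves both.\<close>

lemma category_LieMod:
  assumes "L \<in> Obj C"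
  shows "category (LieMod C (L, lam, Lam))"
  unfolding LieMod_def
proof (rule category_structured_cat)
  fix M assume M: "M \<in> {M. is_lie_module C (L, lam, Lam) M}"
  obtain X \<rho> where [simp]: "M = (X, \<rho>)" by (cases M)
  have X: "X \<in> Obj C" "\<rho> \<in> Hom C (X \<odot> L) X" using M by auto
  show "fst M \<in> Obj C" using X by simp
  show "lie_module_morphism C (L, lam, Lam) M M (Idt C (fst M))"
    using X homD[OF X(2)] assms by simp
next
  fix M N P f g
  assume *: "M \<in> {M. is_lie_module C (L, lam, Lam) M}" "N \<in> {M. is_lie_module C (L, lam, Lam) M}"
    "P \<in> {M. is_lie_module C (L, lam, Lam) M}" "f \<in> Hom C (fst M) (fst N)" "g \<in> Hom C (fst N) (fst P)"
    "lie_module_morphism C (L, lam, Lam) M N f" "lie_module_morphism C (L, lam, Lam) N P g"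
  obtain X \<rho> Y \<sigma> Z \<tau> where [simp]: "M = (X, \<rho>)" "N = (Y, \<sigma>)" "P = (Z, \<tau>)"
    by (cases M; cases N; cases P)
  have hom: "\<rho> \<in> Hom C (X \<odot> L) X" "\<sigma> \<in> Hom C (Y \<odot> L) Y" "\<tau> \<in> Hom C (Z \<odot> L) Z"
    "f \<in> Hom C X Y" "g \<in> Hom C Y Z"
    using * by auto
  note [simp] = homD[OF hom(1)] homD[OF hom(2)] homD[OF hom(3)] homD[OF hom(4)] homD[OF hom(5)] assms
  have f: "f \<cdot> \<rho> = \<sigma> \<cdot> (f \<boxtimes> Idt C L)" and g: "g \<cdot> \<sigma> = \<tau> \<cdot> (g \<boxtimes> Idt C L)"
    using * by auto
  have "(g \<cdot> f) \<cdot> \<rho> = (g \<cdot> \<sigma>) \<cdot> (f \<boxtimes> Idt C L)" by (simp add: arr_assoc f)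
  also have "\<dots> = \<tau> \<cdot> ((g \<boxtimes> Idt C L) \<cdot> (f \<boxtimes> Idt C L))" unfolding g by (simp add: arr_assoc)
  also have "\<dots> = \<tau> \<cdot> ((g \<cdot> f) \<boxtimes> Idt C L)" by (simp add: tensor_interchange)
  finally show "lie_module_morphism C (L, lam, Lam) M P (g \<cdot> f)" by simp
qed

section \<open>The Lie monad - \<otimes> L\<close>

lemma tensor_functor_simps [simp]:
  "a \<in> Obj C \<Longrightarrow> OMap (tensor_functor C L) a = a \<odot> L"
  "f \<in> Arr C \<Longrightarrow> AMap (tensor_functor C L) f = f \<boxtimes> Idt C L"
  by (auto simp: tensor_functor_def)

lemma additive_functor_tensor:
  assumes "L \<in> Obj C" shows "is_additive_functor C C (tensor_functor C L)"
proof -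
  have "OMap (tensor_functor C L) \<in> Obj C \<rightarrow>\<^sub>E Obj C"
    "AMap (tensor_functor C L) \<in> extensional (Arr C)"
    using assms by (auto simp: tensor_functor_def)
  moreover have "AMap (tensor_functor C L) (f \<oplus> g)
      = AMap (tensor_functor C L) f \<oplus> AMap (tensor_functor C L) g"
    if "f \<in> Hom C a b" "g \<in> Hom C a b" for f g a b
    using homD[OF that(1)] homD[OF that(2)] homD[OF add_hom[OF that]]
      tensor_add_left[OF that id_hom[OF assms]] by simp
  moreover have "AMap (tensor_functor C L) (g \<cdot> f)
      = AMap (tensor_functor C L) g \<cdot> AMap (tensor_functor C L) f"
    if "f \<in> Hom C a b" "g \<in> Hom C b c" for f g a b c
    using homD[OF that(1)] homD[OF that(2)] assms by (simp add: tensor_interchange)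
  moreover have "AMap (tensor_functor C L) f
      \<in> Hom C (OMap (tensor_functor C L) a) (OMap (tensor_functor C L) b)"
    if "f \<in> Hom C a b" for f a b
    using homD[OF that] assms by (auto intro!: homI)
  ultimately show ?thesis
    unfolding is_additive_functor_def is_functor_def using category_axioms assms by simp
qed

lemma lie_monad_Mnd:
  assumes yb: "yb_lie_algebra C (L, lam, Lam)"
  shows "lie_monad C (Mnd C (L, lam, Lam))"
proof -
  note L = yb_lie_algebra_hom[OF yb]
  define T where "T = tensor_functor C L"
  let ?TT = "comp_functor C T T"
  define blam where "blam = \<lparr>NSrc = ?TT, NTgt = ?TT, At = (\<lambda>M\<in>Obj C. tens2 C M L lam)\<rparr>"
  define bLam where "bLam = \<lparr>NSrc = ?TT, NTgt = T, At = (\<lambda>M\<in>Obj C. tens1 C M L Lam)\<rparr>"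
  have T: "is_additive_functor C C T" and TT: "is_additive_functor C C ?TT"
    unfolding T_def using L(1) by (auto intro!: additive_functor_comp additive_functor_tensor)
  have obj [simp]: "OMap T M = M \<odot> L" "M \<odot> L \<in> Obj C" if "M \<in> Obj C" for M
    using that L(1) by (auto simp: T_def)
  have arr [simp]: "AMap T f = f \<boxtimes> Idt C L" if "f \<in> Arr C" for f
    using that by (simp add: T_def)
  have at [simp]: "At blam M = tens2 C M L lam" "At bLam M = tens1 C M L Lam" if "M \<in> Obj C" for M
    using that by (auto simp: blam_def bLam_def)
  have ends [simp]: "NSrc blam = ?TT" "NTgt blam = ?TT" "NSrc bLam = ?TT" "NTgt bLam = T"
    by (auto simp: blam_def bLam_def)
  have t2: "tens2 C M L lam \<in> Hom C ((M \<odot> L) \<odot> L) ((M \<odot> L) \<odot> L)"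
    and t1: "tens1 C M L Lam \<in> Hom C ((M \<odot> L) \<odot> L) (M \<odot> L)" if "M \<in> Obj C" for M
    using that L by (auto intro!: tens2_hom tens1_hom)
  note [simp] = L(1) homD(1-3)[OF t2] homD(1-3)[OF t1]
  have blam: "blam \<in> Hom (AddEnd C) ?TT ?TT"
    unfolding AddEnd_hom using TT t2 L(2)
    by (auto simp: homD tens2_natural) (auto simp: blam_def)
  have bLam: "bLam \<in> Hom (AddEnd C) ?TT T"
    unfolding AddEnd_hom using TT T t1 L(4)
    by (auto simp: homD tens1_natural) (auto simp: bLam_def)
  note whisker = whisker_right[OF T blam] whisker_right[OF T bLam] tens1_AddEnd[OF T T bLam]
    tens2_AddEnd[OF T T blam]
  \<comment> \<open>The reversal becomes explicit: the component of \<open>tperm\<close> over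
    \<open>AddEnd C\<close> is the lift of \<open>wperm\<close> over C, and conversely.\<close>
  have perm: "At (tperm (AddEnd C) T blam) M = tens2 C (M \<odot> L) L lam \<cdot> (tens2 C M L lam \<boxtimes> Idt C L)"
    "At (wperm (AddEnd C) T blam) M = (tens2 C M L lam \<boxtimes> Idt C L) \<cdot> tens2 C (M \<odot> L) L lam"
    if "M \<in> Obj C" for M
    using that by (simp_all add: tperm_def wperm_def whisker)
  have perm_ends: "NSrc (tperm (AddEnd C) T blam) = comp_functor C ?TT T"
    "NTgt (tperm (AddEnd C) T blam) = comp_functor C ?TT T"
    "NSrc (wperm (AddEnd C) T blam) = comp_functor C ?TT T"
    "NTgt (wperm (AddEnd C) T blam) = comp_functor C ?TT T"
    by (simp_all add: tperm_def wperm_def whisker)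
  have lLam: "lifts M (Asc C M L L) (Idt C (M \<odot> L)) (tens1 C M L Lam) Lam"
    and llam: "lifts M (Asc C M L L) (Asc C M L L) (tens2 C M L lam) lam"
    and la: "lifts M (asc3 M L) (asc3 M L) (tens2 C M L lam \<boxtimes> Idt C L) (lam \<boxtimes> Idt C L)"
    and lb: "lifts M (asc3 M L) (asc3 M L) (tens2 C (M \<odot> L) L lam) (tens2 C L L lam)"
    and lP: "lifts M (asc3 M L) (Asc C M L L) (tens1 C M L Lam \<boxtimes> Idt C L) (Lam \<boxtimes> Idt C L)"
    and lQ: "lifts M (asc3 M L) (Asc C M L L) (tens1 C (M \<odot> L) L Lam) (tens1 C L L Lam)"
    if "M \<in> Obj C" for M
    using that L by (blast intro: lifts_tens1 lifts_tens2 lifts_tens2_right lifts_tens2_left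
      lifts_tens1_right lifts_tens1_left)+
  note [simp] = homD[OF L(2)] homD[OF L(4)]
  have lt: "lifts M (asc3 M L) (asc3 M L)
      ((tens2 C M L lam \<boxtimes> Idt C L) \<cdot> tens2 C (M \<odot> L) L lam) (tperm C L lam)"
    and lw: "lifts M (asc3 M L) (asc3 M L)
      (tens2 C (M \<odot> L) L lam \<cdot> (tens2 C M L lam \<boxtimes> Idt C L)) (wperm C L lam)"
    if "M \<in> Obj C" for M
    unfolding tperm_def wperm_def
    using lifts_cmp[OF lb[OF that] la[OF that]] lifts_cmp[OF la[OF that] lb[OF that]] by simp_all
  have perm_arr [simp]: "tperm C L lam \<in> Arr C" "Src C (tperm C L lam) = (L \<odot> L) \<odot> L"
    "Tgt C (tperm C L lam) = (L \<odot> L) \<odot> L" "wperm C L lam \<in> Arr C"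
    "Src C (wperm C L lam) = (L \<odot> L) \<odot> L" "Tgt C (wperm C L lam) = (L \<odot> L) \<odot> L"
    by (simp_all add: tperm_def wperm_def)

  \<comment> \<open>The involution, like antisymmetry further down, involves only two copies of L
    and no whiskering, so the given axiom is used unreversed.\<close>
  have inv: "tens2 C M L lam \<cdot> tens2 C M L lam = Idt C ((M \<odot> L) \<odot> L)" if "M \<in> Obj C" for M
    using that L by (simp add: tens2_involution)
  have braid: "tens2 C (M \<odot> L) L lam \<cdot> (tens2 C M L lam \<boxtimes> Idt C L) \<cdot> tens2 C (M \<odot> L) L lam
      = (tens2 C M L lam \<boxtimes> Idt C L) \<cdot> tens2 C (M \<odot> L) L lam \<cdot> (tens2 C M L lam \<boxtimes> Idt C L)"
    if M: "M \<in> Obj C" for M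
  proof (rule lifts_unique)
    show "lifts M (asc3 M L) (asc3 M L)
        (tens2 C (M \<odot> L) L lam \<cdot> (tens2 C M L lam \<boxtimes> Idt C L) \<cdot> tens2 C (M \<odot> L) L lam)
        (tens2 C L L lam \<cdot> (lam \<boxtimes> Idt C L) \<cdot> tens2 C L L lam)"
      using lifts_cmp[OF lb lifts_cmp[OF la lb]] M by simp
    \<comment> \<open>This side naturally lifts the other side of the braid relation on L; the
      relation itself is then used to make the two lifted morphisms agree.\<close>
    have "lifts M (asc3 M L) (asc3 M L)
        ((tens2 C M L lam \<boxtimes> Idt C L) \<cdot> tens2 C (M \<odot> L) L lam \<cdot> (tens2 C M L lam \<boxtimes> Idt C L))
        ((lam \<boxtimes> Idt C L) \<cdot> tens2 C L L lam \<cdot> (lam \<boxtimes> Idt C L))"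
      using lifts_cmp[OF la lifts_cmp[OF lb la]] M by simp
    then show "lifts M (asc3 M L) (asc3 M L)
        ((tens2 C M L lam \<boxtimes> Idt C L) \<cdot> tens2 C (M \<odot> L) L lam \<cdot> (tens2 C M L lam \<boxtimes> Idt C L))
        (tens2 C L L lam \<cdot> (lam \<boxtimes> Idt C L) \<cdot> tens2 C L L lam)"
      using yb by (simp add: symmetric_yang_baxter_def)
  qed
  have anti: "tens1 C M L Lam \<cdot> (Idt C ((M \<odot> L) \<odot> L) \<oplus> tens2 C M L lam)
      = Zero C ((M \<odot> L) \<odot> L) (M \<odot> L)" if M: "M \<in> Obj C" for M
  proof (rule lifts_unique)
    have "lifts M (Asc C M L L) (Asc C M L L) (Idt C ((M \<odot> L) \<odot> L)) (Idt C (L \<odot> L))"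
      using lifts_id[of M "L \<odot> L" "Asc C M L L"] M by simp
    then have "lifts M (Asc C M L L) (Idt C (M \<odot> L))
        (tens1 C M L Lam \<cdot> (Idt C ((M \<odot> L) \<odot> L) \<oplus> tens2 C M L lam)) (Lam \<cdot> (Idt C (L \<odot> L) \<oplus> lam))"
      using M homD[OF add_hom[OF id_hom L(2)]] lifts_cmp[OF lifts_add[OF _ llam[OF M]] lLam[OF M]]
      by simp
    then show "lifts M (Asc C M L L) (Idt C (M \<odot> L))
        (tens1 C M L Lam \<cdot> (Idt C ((M \<odot> L) \<odot> L) \<oplus> tens2 C M L lam)) (Zero C (L \<odot> L) L)"
      using yb by simp
    show "lifts M (Asc C M L L) (Idt C (M \<odot> L)) (Zero C ((M \<odot> L) \<odot> L) (M \<odot> L)) (Zero C (L \<odot> L) L)"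
      using lifts_zero[of M "Asc C M L L" "Idt C (M \<odot> L)" "L \<odot> L" L] M by (simp add: iso_id)
  qed
  \<comment> \<open>Evaluating at \<open>M \<odot> L\<close> puts \<open>Lam\<close> on the last two
    copies and applying \<open>T\<close> puts it on the first two; this is the reversed
    compatibility.\<close>
  have hex: "tens2 C M L lam \<cdot> tens1 C (M \<odot> L) L Lam = (tens1 C M L Lam \<boxtimes> Idt C L)
      \<cdot> (tens2 C (M \<odot> L) L lam \<cdot> (tens2 C M L lam \<boxtimes> Idt C L))" if M: "M \<in> Obj C" for M
  proof (rule lifts_unique)
    show "lifts M (asc3 M L) (Asc C M L L) (tens2 C M L lam \<cdot> tens1 C (M \<odot> L) L Lam)
        (lam \<cdot> tens1 C L L Lam)"
      using lifts_cmp[OF lQ llam] M by simp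
    show "lifts M (asc3 M L) (Asc C M L L) ((tens1 C M L Lam \<boxtimes> Idt C L)
      \<cdot> (tens2 C (M \<odot> L) L lam \<cdot> (tens2 C M L lam \<boxtimes> Idt C L))) (lam \<cdot> tens1 C L L Lam)"
      unfolding yb_lie_algebra_mirror(1)[OF yb] using lifts_cmp[OF lw lP] M by simp
  qed
  \<comment> \<open>The inner bracket is the image under \<open>T\<close> of a component, hence sits
    on the first two copies of L; the exchanged permutations give the order 1, w, t.\<close>
  have jacobi: "tens1 C M L Lam \<cdot> (tens1 C M L Lam \<boxtimes> Idt C L)
      \<cdot> (Idt C (((M \<odot> L) \<odot> L) \<odot> L) \<oplus> tens2 C (M \<odot> L) L lam \<cdot> (tens2 C M L lam \<boxtimes> Idt C L)
        \<oplus> (tens2 C M L lam \<boxtimes> Idt C L) \<cdot> tens2 C (M \<odot> L) L lam)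
      = Zero C (((M \<odot> L) \<odot> L) \<odot> L) (M \<odot> L)" if M: "M \<in> Obj C" for M
  proof (rule lifts_unique)
    let ?id = "Idt C ((L \<odot> L) \<odot> L)"
    have hom: "?id \<in> Hom C ((L \<odot> L) \<odot> L) ((L \<odot> L) \<odot> L)"
      "wperm C L lam \<in> Hom C ((L \<odot> L) \<odot> L) ((L \<odot> L) \<odot> L)"
      "tperm C L lam \<in> Hom C ((L \<odot> L) \<odot> L) ((L \<odot> L) \<odot> L)"
      by (auto intro!: homI)
    note sum = add_hom[OF hom(1,2)] add_hom[OF add_hom[OF hom(1,2)] hom(3)]
    have "lifts M (asc3 M L) (asc3 M L) (Idt C (((M \<odot> L) \<odot> L) \<odot> L)) ?id"
      using lifts_id[of M "(L \<odot> L) \<odot> L" "asc3 M L"] M by simp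
    then show "lifts M (asc3 M L) (Idt C (M \<odot> L)) (tens1 C M L Lam \<cdot> (tens1 C M L Lam \<boxtimes> Idt C L)
      \<cdot> (Idt C (((M \<odot> L) \<odot> L) \<odot> L) \<oplus> tens2 C (M \<odot> L) L lam \<cdot> (tens2 C M L lam \<boxtimes> Idt C L)
        \<oplus> (tens2 C M L lam \<boxtimes> Idt C L) \<cdot> tens2 C (M \<odot> L) L lam)) (Zero C ((L \<odot> L) \<odot> L) L)"
      unfolding yb_lie_algebra_mirror(2)[OF yb, symmetric]
      using homD[OF sum(1)] homD[OF sum(2)] M
        lifts_cmp[OF lifts_add[OF lifts_add[OF _ lw[OF M]] lt[OF M]] lifts_cmp[OF lP[OF M] lLam[OF M]]]
      by simp
    show "lifts M (asc3 M L) (Idt C (M \<odot> L)) (Zero C (((M \<odot> L) \<odot> L) \<odot> L) (M \<odot> L))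
        (Zero C ((L \<odot> L) \<odot> L) L)"
      using lifts_zero[of M "asc3 M L" "Idt C (M \<odot> L)" "(L \<odot> L) \<odot> L" L] M by (simp add: iso_id)
  qed

  \<comment> \<open>Equality of transformations is equality of restricted functions. The congruence
    rule supplies \<open>M \<in> Obj C\<close> when a component is rewritten, as each componentwise
    identity requires.\<close>
  have "symmetric_yang_baxter (AddEnd C) T blam"
    unfolding symmetric_yang_baxter_def
    using blam by (simp add: whisker inv braid id_ntrans_def[of C ?TT] cong: restrict_cong)
  then have "yb_lie_algebra (AddEnd C) (T, blam, bLam)"
    using T blam bLam
    by (simp add: whisker perm perm_ends anti hex jacobi comp_functor_assoc[OF T] cong: restrict_cong)
  then show ?thesis
    by (simp add: lie_monad_def T_def blam_def bLam_def Let_def)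
qed

end

theorem proposition4p9:
  fixes C :: "('o, 'm, 'z) mon_cat_scheme"
    and L :: 'o and lam Lam :: 'm
  assumes "additive_monoidal_category C"
    and "yb_lie_algebra C (L, lam, Lam)"
  shows "lie_monad C (Mnd C (L, lam, Lam)) \<and>
    (\<exists>F. is_equivalence (LieMod C (L, lam, Lam)) (EML C (Mnd C (L, lam, Lam))) F)"
proof -
  interpret additive_monoidal_category C by (rule assms(1))
  have "category (LieMod C (L, lam, Lam))"
    by (rule category_LieMod[OF yb_lie_algebra_hom(1)[OF assms(2)]])
  then show ?thesis
    using lie_monad_Mnd[OF assms(2)] category.is_equivalence_id
    unfolding LieMod_eq_EML[OF assms(2)] by blast
qed

end
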